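(* Let $Y \subseteq \mathbb{R}^m$ be a closed convex set. Then $Y$ is attainable by Player 1 (in the continuous-time game based on $G=(A_1,A_2,u)$) if and only if there exist $\alpha>0$ and two $B$-sets $C$ and $C'$ for Player 1 such that $$\alpha C + \mathrm{Cone}(C') \subseteq Y .$$
   Context: **Game.** $A_1,A_2$ are finite nonempty action sets of Players 1 and 2, $m\ge 1$ is an integer, and $u:A_1\times A_2\to[-1,1]^m$ is a vector payoff function, extended bilinearly to $\Delta(A_1)\times\Delta(A_2)$, where $\Delta(A_i)$ is the set of mixed actions (probability distributions on $A_i$). $G=(A_1,A_2,u)$ is the one-shot game. The continuous-time game $\Gamma$ based on $G$ is played over $[0,\infty)$. **Strategies.** Let $\mathcal{C}_i$ be the set of controls of player $i$, i.e. measurable functions $a_i:[0,\infty)\to\Delta(A_i)$; $-i$ denotes the opponent of $i$. A strategy of player $i$ is a function $\sigma_i:\mathcal{C}_{-i}\to\mathcal{C}_i$ for which there is a strictly increasing sequence $0=\tau_i^0<\tau_i^1<\tau_i^2<\cdots$ of real numbers with $\tau_i^k\to\infty$ such that for all $a_{-i},a'_{-i}\in\mathcal{C}_{-i}$ and all $k\ge 0$: if $a_{-i}(t)=a'_{-i}(t)$ for all $t\in[0,\tau_i^k)$, then $(\sigma_i(a_{-i}))(t)=(\sigma_i(a'_{-i}))(t)$ for all $t\in[\tau_i^k,\tau_i^{k+1})$. A pair of strategies $\sigma=(\sigma_1,\sigma_2)$ determines a unique play path $a^\sigma=(a_1,a_2)\in\mathcal{C}_1\times\mathcal{C}_2$ with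 $\sigma_1(a_2)=a_1$ and $\sigma_2(a_1)=a_2$. **Payoffs.** The cumulative payoff up to time $t$ is $\gamma^t(\sigma)=\int_0^t u(a^\sigma(s))\,ds\in\mathbb{R}^m$. **Distance.** $\|\cdot\|$ is the Euclidean norm and $d(x,A)=\inf_{y\in A}\|x-y\|$. **Attainability.** A nonempty closed set $Y\subseteq\mathbb{R}^m$ is attainable by Player 1 if there is $T>0$ such that for every $\varepsilon>0$ there is a strategy $\sigma_1$ of Player 1 with $d(\gamma^t(\sigma_1,\sigma_2),Y)\le\varepsilon$ for all $t\ge T$ and all strategies $\sigma_2$ of Player 2. (The time $T$ does not depend on $\varepsilon$.) **$B$-sets.** For a nonempty closed set $C\subseteq\mathbb{R}^m$ and $z\in\mathbb{R}^m$, $\Pi_C(z)=\{c\in C: \|z-c\|=d(z,C)\}$. A nonempty closed set $C\subseteq\mathbb{R}^m$ is a $B$-set for Player 1 if for every $z\in\mathbb{R}^m$ there exist $c\in\Pi_C(z)$ and $x\in\Delta(A_1)$ such that $\langle u(x,a_2)-c,\,z-c\rangle\le 0$ for all $a_2\in A_2$. **Cone.** $\mathrm{Cone}(C')=\{\beta y:\beta\ge 0,\ y\in C'\}$. *)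

theory Defs
  imports "HOL-Probability.Probability"
begin

text \<open>
  The action sets of the two players are the finite types \<open>'a\<close> and \<open>'b\<close>; mixed actions are
  probability mass functions. A payoff function is \<open>u :: 'a \<Rightarrow> 'b \<Rightarrow> real ^ 'm\<close>, extended
  bilinearly to mixed actions.
\<close>

definition mixed_payoff ::
    "('a::finite \<Rightarrow> 'b::finite \<Rightarrow> real ^ 'm) \<Rightarrow> 'a pmf \<Rightarrow> 'b pmf \<Rightarrow> real ^ 'm" where
  "mixed_payoff u p q = (\<Sum>x\<in>UNIV. \<Sum>y\<in>UNIV. (pmf p x * pmf q y) *\<^sub>R u x y)"

text \<open>
  Controls are functions on \<open>[0,\<infinity>)\<close>, represented extensionally (\<open>undefined\<close> at negative times), so
  that equality of controls is equality on \<open>[0,\<infinity>)\<close>. Since the action set is finite, (Lebesgue)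
  measurability of a map into the simplex of mixed actions is measurability of its coordinates.
\<close>

definition controls :: "(real \<Rightarrow> 'a::finite pmf) set" where
  "controls = {a \<in> extensional {0..}.
     \<forall>x. (\<lambda>t. pmf (a t) x) \<in> borel_measurable (lebesgue_on {0..})}"

text \<open>
  Strategies map controls of the opponent (with actions \<open>'b\<close>) to controls of the player
  (with actions \<open>'a\<close>); the same definition serves both players. Values outside \<open>controls\<close> are
  irrelevant.
\<close>

definition strategies :: "((real \<Rightarrow> 'b::finite pmf) \<Rightarrow> (real \<Rightarrow> 'a::finite pmf)) set" where
  "strategies = {\<sigma> \<in> controls \<rightarrow> controls.
     \<exists>\<tau> :: nat \<Rightarrow> real. \<tau> 0 = 0 \<and> strict_mono \<tau> \<and> filterlim \<tau> at_top sequentially \<and>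
       (\<forall>a\<in>controls. \<forall>a'\<in>controls. \<forall>k.
          (\<forall>t\<in>{0..<\<tau> k}. a t = a' t) \<longrightarrow>
          (\<forall>t\<in>{\<tau> k..<\<tau> (Suc k)}. \<sigma> a t = \<sigma> a' t))}"

definition is_play_path ::
    "((real \<Rightarrow> 'b::finite pmf) \<Rightarrow> (real \<Rightarrow> 'a::finite pmf)) \<Rightarrow>
     ((real \<Rightarrow> 'a pmf) \<Rightarrow> (real \<Rightarrow> 'b pmf)) \<Rightarrow>
     (real \<Rightarrow> 'a pmf) \<times> (real \<Rightarrow> 'b pmf) \<Rightarrow> bool" where
  "is_play_path \<sigma>1 \<sigma>2 p \<longleftrightarrow>
     fst p \<in> controls \<and> snd p \<in> controls \<and> \<sigma>1 (snd p) = fst p \<and> \<sigma>2 (fst p) = snd p"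

text \<open>Well-defined for strategies by \<open>ex1_play_path\<close> below.\<close>

definition play_path ::
    "((real \<Rightarrow> 'b::finite pmf) \<Rightarrow> (real \<Rightarrow> 'a::finite pmf)) \<Rightarrow>
     ((real \<Rightarrow> 'a pmf) \<Rightarrow> (real \<Rightarrow> 'b pmf)) \<Rightarrow>
     (real \<Rightarrow> 'a pmf) \<times> (real \<Rightarrow> 'b pmf)" where
  "play_path \<sigma>1 \<sigma>2 = (THE p. is_play_path \<sigma>1 \<sigma>2 p)"

definition cumulative_payoff ::
    "('a::finite \<Rightarrow> 'b::finite \<Rightarrow> real ^ 'm) \<Rightarrow>
     ((real \<Rightarrow> 'b pmf) \<Rightarrow> (real \<Rightarrow> 'a pmf)) \<Rightarrow> ((real \<Rightarrow> 'a pmf) \<Rightarrow> (real \<Rightarrow> 'b pmf)) \<Rightarrow>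
     real \<Rightarrow> real ^ 'm" where
  "cumulative_payoff u \<sigma>1 \<sigma>2 t =
     (LINT s:{0..t}|lebesgue. mixed_payoff u (fst (play_path \<sigma>1 \<sigma>2) s) (snd (play_path \<sigma>1 \<sigma>2) s))"

text \<open>Below, \<open>infdist\<close> is only applied to nonempty sets, where it is \<open>inf {dist x y | y \<in> A}\<close>.\<close>

definition attainable :: "('a::finite \<Rightarrow> 'b::finite \<Rightarrow> real ^ 'm) \<Rightarrow> (real ^ 'm) set \<Rightarrow> bool" where
  "attainable u Y \<longleftrightarrow> Y \<noteq> {} \<and> closed Y \<and>
     (\<exists>T>0. \<forall>\<epsilon>>0. \<exists>\<sigma>1\<in>strategies. \<forall>t\<ge>T. \<forall>\<sigma>2\<in>strategies.
        infdist (cumulative_payoff u \<sigma>1 \<sigma>2 t) Y \<le> \<epsilon>)"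

definition nearest_points :: "(real ^ 'm) set \<Rightarrow> real ^ 'm \<Rightarrow> (real ^ 'm) set" where
  "nearest_points C z = {c \<in> C. norm (z - c) = infdist z C}"

definition B_set :: "('a::finite \<Rightarrow> 'b::finite \<Rightarrow> real ^ 'm) \<Rightarrow> (real ^ 'm) set \<Rightarrow> bool" where
  "B_set u C \<longleftrightarrow> C \<noteq> {} \<and> closed C \<and>
     (\<forall>z. \<exists>c\<in>nearest_points C z. \<exists>x :: 'a pmf. \<forall>y :: 'b.
        inner (mixed_payoff u x (return_pmf y) - c) (z - c) \<le> 0)"

definition Cone :: "(real ^ 'm) set \<Rightarrow> (real ^ 'm) set" where
  "Cone C = {\<beta> *\<^sub>R y | \<beta> y. 0 \<le> \<beta> \<and> y \<in> C}"


subsection \<open>Existence and uniqueness of the play path\<close>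

lemma strict_mono_grid_point:
  fixes \<tau> :: "nat \<Rightarrow> real"
  assumes "\<tau> 0 = 0" "strict_mono \<tau>" "filterlim \<tau> at_top sequentially" "0 \<le> t"
  obtains k where "\<tau> k \<le> t" "t < \<tau> (Suc k)"
proof -
  have "\<forall>\<^sub>F n in sequentially. t < \<tau> n"
    using assms(3) by (simp add: filterlim_at_top_dense)
  then have "\<exists>n. t < \<tau> n"
    by (auto simp: eventually_sequentially)
  define n where "n = (LEAST n. t < \<tau> n)"
  have n: "t < \<tau> n" unfolding n_def using \<open>\<exists>n. t < \<tau> n\<close> by (rule LeastI_ex)
  then obtain k where k: "n = Suc k" using assms(1,4) by (cases n) auto
  have "\<not> t < \<tau> k" using not_less_Least[of k "\<lambda>n. t < \<tau> n"] k n_def by auto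
  then show thesis using that[of k] n k by auto
qed

lemma finite_grid:
  fixes \<tau> :: "nat \<Rightarrow> real"
  assumes "filterlim \<tau> at_top sequentially"
  shows "finite {k. \<tau> k \<le> t}"
proof -
  have "\<forall>\<^sub>F k in sequentially. t < \<tau> k"
    using assms by (simp add: filterlim_at_top_dense)
  then obtain N where "\<And>k. k \<ge> N \<Longrightarrow> t < \<tau> k" by (auto simp: eventually_sequentially)
  then have "{k. \<tau> k \<le> t} \<subseteq> {..<N}" by (metis (no_types, lifting) linorder_not_less lessThan_iff mem_Collect_eq subsetI)
  then show ?thesis by (rule finite_subset) simp
qed

lemma const_in_controls: "restrict (\<lambda>t. p) {0..} \<in> controls"
proof -
  have "(\<lambda>t. pmf (restrict (\<lambda>t. p) {0..} t) x) \<in> borel_measurable (lebesgue_on {0::real..})" for x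
    by (rule measurable_cong[where g = "\<lambda>t. pmf p x", THEN iffD2]) auto
  then show ?thesis by (auto simp: controls_def)
qed

proposition ex1_play_path:
  fixes \<sigma>1 :: "(real \<Rightarrow> 'b::finite pmf) \<Rightarrow> (real \<Rightarrow> 'a::finite pmf)"
  assumes s1: "\<sigma>1 \<in> strategies" and s2: "\<sigma>2 \<in> strategies"
  shows "\<exists>!p. is_play_path \<sigma>1 \<sigma>2 p"
proof -
  from s1 obtain \<tau>1 :: "nat \<Rightarrow> real" where
      g1: "\<tau>1 0 = 0" "strict_mono \<tau>1" "filterlim \<tau>1 at_top sequentially" and
      gr1: "\<forall>a\<in>controls. \<forall>a'\<in>controls. \<forall>k.
          (\<forall>t\<in>{0..<\<tau>1 k}. a t = a' t) \<longrightarrow>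
          (\<forall>t\<in>{\<tau>1 k..<\<tau>1 (Suc k)}. \<sigma>1 a t = \<sigma>1 a' t)"
    unfolding strategies_def by blast
  have n1: "\<sigma>1 a t = \<sigma>1 a' t"
    if "a \<in> controls" "a' \<in> controls" "\<forall>t\<in>{0..<\<tau>1 k}. a t = a' t" "\<tau>1 k \<le> t" "t < \<tau>1 (Suc k)"
    for a a' k t
    using bspec[OF mp[OF spec[OF bspec[OF bspec[OF gr1 that(1)] that(2)]] that(3)], of t] that(4,5) by simp
  from s2 obtain \<tau>2 :: "nat \<Rightarrow> real" where
      g2: "\<tau>2 0 = 0" "strict_mono \<tau>2" "filterlim \<tau>2 at_top sequentially" and
      gr2: "\<forall>a\<in>controls. \<forall>a'\<in>controls. \<forall>k.
          (\<forall>t\<in>{0..<\<tau>2 k}. a t = a' t) \<longrightarrow>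
          (\<forall>t\<in>{\<tau>2 k..<\<tau>2 (Suc k)}. \<sigma>2 a t = \<sigma>2 a' t)"
    unfolding strategies_def by blast
  have n2: "\<sigma>2 a t = \<sigma>2 a' t"
    if "a \<in> controls" "a' \<in> controls" "\<forall>t\<in>{0..<\<tau>2 k}. a t = a' t" "\<tau>2 k \<le> t" "t < \<tau>2 (Suc k)"
    for a a' k t
    using bspec[OF mp[OF spec[OF bspec[OF bspec[OF gr2 that(1)] that(2)]] that(3)], of t] that(4,5) by simp
  have c1: "\<sigma>1 a \<in> controls" if "a \<in> controls" for a using s1 that by (auto simp: strategies_def)
  have c2: "\<sigma>2 a \<in> controls" if "a \<in> controls" for a using s2 that by (auto simp: strategies_def)

  define f where "f p = (\<sigma>1 (snd p), \<sigma>2 (fst p))" for p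
  have f_simps: "fst (f p) = \<sigma>1 (snd p)" "snd (f p) = \<sigma>2 (fst p)" for p
    by (simp_all add: f_def)
  define c where "c t = card {k. \<tau>1 k \<le> t} + card {k. \<tau>2 k \<le> t}" for t
  have c_mono: "c s \<le> c t" if "s \<le> t" for s t
    unfolding c_def using that
    by (intro add_mono card_mono finite_grid g1 g2) auto
  have c_less1: "c s < c t" if "s < \<tau>1 k" "\<tau>1 k \<le> t" for s t k
  proof -
    have "k \<in> {k. \<tau>1 k \<le> t} - {k. \<tau>1 k \<le> s}" using that by simp
    moreover have "{k. \<tau>1 k \<le> s} \<subseteq> {k. \<tau>1 k \<le> t}" using that by auto
    ultimately have "{k. \<tau>1 k \<le> s} \<subset> {k. \<tau>1 k \<le> t}" by blast
    then have "card {k. \<tau>1 k \<le> s} < card {k. \<tau>1 k \<le> t}"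
      by (intro psubset_card_mono finite_grid g1)
    moreover have "card {k. \<tau>2 k \<le> s} \<le> card {k. \<tau>2 k \<le> t}"
      using that by (intro card_mono finite_grid g2) auto
    ultimately show ?thesis by (simp add: c_def)
  qed
  have c_less2: "c s < c t" if "s < \<tau>2 k" "\<tau>2 k \<le> t" for s t k
  proof -
    have "k \<in> {k. \<tau>2 k \<le> t} - {k. \<tau>2 k \<le> s}" using that by simp
    moreover have "{k. \<tau>2 k \<le> s} \<subseteq> {k. \<tau>2 k \<le> t}" using that by auto
    ultimately have "{k. \<tau>2 k \<le> s} \<subset> {k. \<tau>2 k \<le> t}" by blast
    then have "card {k. \<tau>2 k \<le> s} < card {k. \<tau>2 k \<le> t}"
      by (intro psubset_card_mono finite_grid g2)
    moreover have "card {k. \<tau>1 k \<le> s} \<le> card {k. \<tau>1 k \<le> t}"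
      using that by (intro card_mono finite_grid g1) auto
    ultimately show ?thesis by (simp add: c_def)
  qed
  have c_pos: "c t > 0" if "0 \<le> t" for t
  proof -
    have "0 \<in> {k. \<tau>1 k \<le> t}" using that g1 by simp
    then have "card {k. \<tau>1 k \<le> t} > 0" using finite_grid[OF g1(3)] card_gt_0_iff by blast
    then show ?thesis by (simp add: c_def)
  qed

  have it: "fst ((f ^^ n) p) \<in> controls \<and> snd ((f ^^ n) p) \<in> controls"
    if "fst p \<in> controls" "snd p \<in> controls" for n p
    using that by (induction n) (auto simp: f_simps c1 c2)

  have agree: "fst ((f ^^ n) p) t = fst ((f ^^ n) q) t \<and> snd ((f ^^ n) p) t = snd ((f ^^ n) q) t"
    if p: "fst p \<in> controls" "snd p \<in> controls" and q: "fst q \<in> controls" "snd q \<in> controls"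
      and "0 \<le> t" "c t \<le> n" for n p q t
    using \<open>0 \<le> t\<close> \<open>c t \<le> n\<close>
  proof (induction n arbitrary: t)
    case 0
    then show ?case using c_pos[of t] by simp
  next
    case (Suc n)
    obtain k where k: "\<tau>1 k \<le> t" "t < \<tau>1 (Suc k)"
      using strict_mono_grid_point[OF g1 \<open>0 \<le> t\<close>] by blast
    have "\<forall>s\<in>{0..<\<tau>1 k}. snd ((f ^^ n) p) s = snd ((f ^^ n) q) s"
    proof
      fix s assume s: "s \<in> {0..<\<tau>1 k}"
      then have "c s \<le> n" using c_less1[of s k t] k(1) Suc.prems(2) by simp
      then show "snd ((f ^^ n) p) s = snd ((f ^^ n) q) s" using Suc.IH[of s] s by simp
    qed
    then have A: "\<sigma>1 (snd ((f ^^ n) p)) t = \<sigma>1 (snd ((f ^^ n) q)) t"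
      by - (rule n1[OF _ _ _ k]; simp_all add: it p q)
    obtain l where l: "\<tau>2 l \<le> t" "t < \<tau>2 (Suc l)"
      using strict_mono_grid_point[OF g2 \<open>0 \<le> t\<close>] by blast
    have "\<forall>s\<in>{0..<\<tau>2 l}. fst ((f ^^ n) p) s = fst ((f ^^ n) q) s"
    proof
      fix s assume s: "s \<in> {0..<\<tau>2 l}"
      then have "c s \<le> n" using c_less2[of s l t] l(1) Suc.prems(2) by simp
      then show "fst ((f ^^ n) p) s = fst ((f ^^ n) q) s" using Suc.IH[of s] s by simp
    qed
    then have B: "\<sigma>2 (fst ((f ^^ n) p)) t = \<sigma>2 (fst ((f ^^ n) q)) t"
      by - (rule n2[OF _ _ _ l]; simp_all add: it p q)
    show ?case using A B by (simp add: f_simps)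
  qed

  define p0 where "p0 = (restrict (\<lambda>t. return_pmf undefined) {0..} :: real \<Rightarrow> 'a pmf,
                         restrict (\<lambda>t. return_pmf undefined) {0..} :: real \<Rightarrow> 'b pmf)"
  have p0: "fst p0 \<in> controls" "snd p0 \<in> controls"
    unfolding p0_def by (simp_all add: const_in_controls del: restrict_apply)
  define a1 where "a1 = restrict (\<lambda>t. fst ((f ^^ c t) p0) t) {0..}"
  define a2 where "a2 = restrict (\<lambda>t. snd ((f ^^ c t) p0) t) {0..}"
  have stab: "fst ((f ^^ n) p0) t = a1 t" "snd ((f ^^ n) p0) t = a2 t"
    if "0 \<le> t" "c t \<le> n" for n t
  proof -
    have eq: "(f ^^ n) p0 = (f ^^ c t) ((f ^^ (n - c t)) p0)"
      using that(2) by (metis funpow_add le_add_diff_inverse o_apply)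
    show "fst ((f ^^ n) p0) t = a1 t" "snd ((f ^^ n) p0) t = a2 t"
      using agree[OF _ _ p0 that(1) order_refl, of "(f ^^ (n - c t)) p0"] it[OF p0] that(1)
      by (auto simp: eq a1_def a2_def)
  qed
  have lim1: "(\<lambda>n. pmf (fst ((f ^^ n) p0) t) x) \<longlonglongrightarrow> pmf (a1 t) x" if "0 \<le> t" for t x
    by (rule tendsto_eventually) (rule eventually_sequentiallyI[of "c t"], simp add: stab[OF that])
  have lim2: "(\<lambda>n. pmf (snd ((f ^^ n) p0) t) x) \<longlonglongrightarrow> pmf (a2 t) x" if "0 \<le> t" for t x
    by (rule tendsto_eventually) (rule eventually_sequentiallyI[of "c t"], simp add: stab[OF that])
  have "(\<lambda>t. pmf (a1 t) x) \<in> borel_measurable (lebesgue_on {0..})" for x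
    by (rule borel_measurable_LIMSEQ_real[of _ "\<lambda>n t. pmf (fst ((f ^^ n) p0) t) x"])
       (use lim1 it[OF p0] in \<open>auto simp: controls_def\<close>)
  then have a1: "a1 \<in> controls" by (auto simp: controls_def a1_def)
  have "(\<lambda>t. pmf (a2 t) x) \<in> borel_measurable (lebesgue_on {0..})" for x
    by (rule borel_measurable_LIMSEQ_real[of _ "\<lambda>n t. pmf (snd ((f ^^ n) p0) t) x"])
       (use lim2 it[OF p0] in \<open>auto simp: controls_def\<close>)
  then have a2: "a2 \<in> controls" by (auto simp: controls_def a2_def)

  have "\<sigma>1 a2 t = a1 t" for t
  proof (cases "0 \<le> t")
    case True
    obtain k where k: "\<tau>1 k \<le> t" "t < \<tau>1 (Suc k)"
      using strict_mono_grid_point[OF g1 True] by blast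
    have "\<forall>s\<in>{0..<\<tau>1 k}. a2 s = snd ((f ^^ c t) p0) s"
      using stab(2) c_mono k(1) by force
    then have "\<sigma>1 a2 t = \<sigma>1 (snd ((f ^^ c t) p0)) t"
      by - (rule n1[OF a2 _ _ k]; simp_all add: it[OF p0])
    also have "\<dots> = fst ((f ^^ Suc (c t)) p0) t" by (simp add: f_simps)
    also have "\<dots> = a1 t" by (rule stab) (use True in auto)
    finally show ?thesis .
  next
    case False
    then show ?thesis using a1 c1[OF a2] by (auto simp: controls_def extensional_def)
  qed
  moreover have "\<sigma>2 a1 t = a2 t" for t
  proof (cases "0 \<le> t")
    case True
    obtain k where k: "\<tau>2 k \<le> t" "t < \<tau>2 (Suc k)"
      using strict_mono_grid_point[OF g2 True] by blast
    have "\<forall>s\<in>{0..<\<tau>2 k}. a1 s = fst ((f ^^ c t) p0) s"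
      using stab(1) c_mono k(1) by force
    then have "\<sigma>2 a1 t = \<sigma>2 (fst ((f ^^ c t) p0)) t"
      by - (rule n2[OF a1 _ _ k]; simp_all add: it[OF p0])
    also have "\<dots> = snd ((f ^^ Suc (c t)) p0) t" by (simp add: f_simps)
    also have "\<dots> = a2 t" by (rule stab) (use True in auto)
    finally show ?thesis .
  next
    case False
    then show ?thesis using a2 c2[OF a1] by (auto simp: controls_def extensional_def)
  qed
  ultimately have ex: "is_play_path \<sigma>1 \<sigma>2 (a1, a2)"
    using a1 a2 by (auto simp: is_play_path_def)

  have uniq: "p = q" if "is_play_path \<sigma>1 \<sigma>2 p" "is_play_path \<sigma>1 \<sigma>2 q" for p q
  proof -
    have cp: "fst p \<in> controls" "snd p \<in> controls" and cq: "fst q \<in> controls" "snd q \<in> controls"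
      using that by (auto simp: is_play_path_def)
    have "f p = p" "f q = q" using that by (auto simp: is_play_path_def f_def)
    then have fixed: "(f ^^ n) p = p" "(f ^^ n) q = q" for n by (induction n) auto
    have "fst p t = fst q t \<and> snd p t = snd q t" for t
    proof (cases "0 \<le> t")
      case True
      then show ?thesis using agree[OF cp cq True order_refl] fixed by simp
    next
      case False
      then show ?thesis using cp cq by (auto simp: controls_def extensional_def)
    qed
    then show ?thesis by (simp add: prod_eq_iff fun_eq_iff)
  qed
  show ?thesis using ex uniq by blast
qed

end

theory Submission
  imports Defs
begin

text \<open>
  Suppose that \<open>Y\<close> is attainable from time \<open>T\<close> on. Take \<open>\<alpha> = T\<close>, \<open>C = Y / T\<close>, and for \<open>C'\<close> the
  recession cone of \<open>Y\<close>. Then \<open>\<alpha> C + Cone C' \<subseteq> Y\<close> holds by definition of the recession cone, and it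
  remains to see that both sets are \<open>B\<close>-sets. Both are closed and convex, so by the minimax theorem it
  is enough to find, for each mixed action \<open>q\<close> of Player 2, a reply \<open>p\<close> with \<open>u(p, q)\<close> in the set
  (\<open>B_set_if_dual_condition\<close>). Let Player 2 repeat \<open>q\<close> for ever. The payoff at time \<open>t\<close> is then
  \<open>t u(p, q)\<close> for the time average \<open>p\<close> of Player 1's control. At \<open>t = T\<close> it is arbitrarily close to \<open>Y\<close>,
  which gives a reply for \<open>Y / T\<close>; as \<open>t\<close> grows, \<open>u(p, q)\<close> accumulates at directions of recession of \<open>Y\<close>
  (\<open>B_sets_if_attainable\<close>).

  Conversely, let \<open>\<alpha> C + Cone C' \<subseteq> Y\<close> with \<open>B\<close>-sets \<open>C\<close> and \<open>C'\<close>. Whenever Player 1 reacts to the current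
  average payoff as the \<open>B\<close>-set condition for \<open>C\<close> prescribes, and holds that action for a time \<open>h\<close>, the
  squared distance of the cumulative payoff \<open>\<gamma>\<close> from \<open>t C\<close> grows by at most a constant times \<open>h\<^sup>2\<close>
  (\<open>B_set_step\<close>). Step lengths with divergent sum and small sum of squares, such as a small multiple of
  \<open>1, 1/2, 1/3, \<dots>\<close>, therefore keep \<open>\<gamma>\<close> near \<open>t C\<close> at all times (\<open>block_strategy_tracks\<close>). Tracking \<open>t C\<close>
  until time \<open>\<alpha>\<close> and then, with a fresh start, \<open>(t - \<alpha>) C'\<close> keeps \<open>\<gamma>\<close> near \<open>\<alpha> C + Cone C'\<close> from time \<open>\<alpha>\<close>
  on, for every \<open>\<epsilon>\<close> (\<open>attainable_if_B_sets\<close>).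
\<close>


section \<open>Mixed actions and expected payoffs\<close>

lemma ex_pmf_of_weights:
  fixes w :: "'a::finite \<Rightarrow> real"
  assumes "\<And>x. 0 \<le> w x" and "sum w UNIV = 1"
  shows "\<exists>p. \<forall>x. pmf p x = w x"
proof -
  have "(\<integral>\<^sup>+x. ennreal (w x) \<partial>count_space UNIV) = 1"
    using assms by (simp add: nn_integral_count_space_finite sum_ennreal)
  then show ?thesis using pmf_embed_pmf[of w] assms(1) by blast
qed

lemma sum_pmf_UNIV: "(\<Sum>x\<in>UNIV. pmf (p :: 'a::finite pmf) x) = 1"
  by (rule sum_pmf_eq_1) auto

text \<open>
  The set of payoffs that a player's mixed actions can realise is thus a polytope. This gives both
  its compactness and the access to separation theorems.
\<close>

lemma convex_hull_range_eq_pmf_averages: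
  fixes g :: "'a::finite \<Rightarrow> 'v::real_vector"
  shows "convex hull (range g) = range (\<lambda>p :: 'a pmf. \<Sum>x\<in>UNIV. pmf p x *\<^sub>R g x)"
proof
  let ?A = "\<lambda>p :: 'a pmf. \<Sum>x\<in>UNIV. pmf p x *\<^sub>R g x"
  show "convex hull (range g) \<subseteq> range ?A"
  proof (rule hull_minimal)
    have pure: "g x = ?A (return_pmf x)" for x
      by (simp add: indicator_def of_bool_def if_distrib[of "\<lambda>r. r *\<^sub>R _"] cong: if_cong)
    show "range g \<subseteq> range ?A"
      by (intro image_subsetI, subst pure) (rule rangeI)
    show "convex (range ?A)"
    proof (rule convexI, clarify)
      fix p q :: "'a pmf" and a b :: real
      assume ab: "0 \<le> a" "0 \<le> b" "a + b = 1"
      then obtain r :: "'a pmf" where r: "\<And>x. pmf r x = a * pmf p x + b * pmf q x"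
        using ex_pmf_of_weights[of "\<lambda>x. a * pmf p x + b * pmf q x"]
        by (auto simp: sum.distrib sum_distrib_left[symmetric] sum_pmf_UNIV)
      have "a *\<^sub>R ?A p + b *\<^sub>R ?A q = ?A r"
        by (simp add: r scaleR_right.sum scaleR_left_distrib sum.distrib)
      then show "a *\<^sub>R ?A p + b *\<^sub>R ?A q \<in> range ?A" by simp
    qed
  qed
  show "range ?A \<subseteq> convex hull (range g)"
    by (auto intro!: convex_sum[OF _ convex_convex_hull] intro: hull_inc simp: sum_pmf_UNIV)
qed

text \<open>
  Bilinearity, in the two forms that are used: a mixed payoff is an average over the pure actions
  of either player.
\<close>

lemma mixed_payoff_average_right:
  "mixed_payoff u p q = (\<Sum>y\<in>UNIV. pmf q y *\<^sub>R mixed_payoff u p (return_pmf y))"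
proof -
  have "mixed_payoff u p (return_pmf y) = (\<Sum>x\<in>UNIV. pmf p x *\<^sub>R u x y)" for y
    by (simp add: mixed_payoff_def indicator_def of_bool_def if_distrib[of "\<lambda>r. _ * r"]
        if_distrib[of "\<lambda>r. r *\<^sub>R _"] cong: if_cong)
  then show ?thesis
    by (simp add: mixed_payoff_def scaleR_right.sum mult.commute) (rule sum.swap)
qed

lemma mixed_payoff_average_left:
  "mixed_payoff u p q = (\<Sum>x\<in>UNIV. pmf p x *\<^sub>R mixed_payoff u (return_pmf x) q)"
proof -
  have "mixed_payoff u (return_pmf x) q = (\<Sum>y\<in>UNIV. pmf q y *\<^sub>R u x y)" for x
    by (subst mixed_payoff_def, subst sum.swap)
      (simp add: indicator_def of_bool_def if_distrib[of "\<lambda>r. r * _"]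
        if_distrib[of "\<lambda>r. r *\<^sub>R _"] cong: if_cong)
  then show ?thesis
    by (simp add: mixed_payoff_def scaleR_right.sum)
qed

lemma norm_mixed_payoff_le:
  "norm (mixed_payoff u p q) \<le> (\<Sum>x\<in>UNIV. \<Sum>y\<in>UNIV. norm (u x y))"
  unfolding mixed_payoff_def
proof (intro sum_norm_le)
  fix x y
  have "pmf p x * pmf q y \<le> 1" by (simp add: mult_le_one pmf_le_1)
  then show "norm ((pmf p x * pmf q y) *\<^sub>R u x y) \<le> norm (u x y)"
    by (simp add: mult_left_le_one_le)
qed

text \<open>
  The inequality in the definition of a \<open>B\<close>-set is linear in the opponent's action, so that it
  carries over from pure to mixed actions.
\<close>

lemma inner_mixed_payoff_le:
  assumes "\<And>y. inner (mixed_payoff u p (return_pmf y) - c) d \<le> 0"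
  shows "inner (mixed_payoff u p q - c) d \<le> 0"
proof -
  have "c = (\<Sum>y\<in>UNIV. pmf q y *\<^sub>R c)"
    by (simp add: scaleR_left.sum[symmetric] sum_pmf_UNIV)
  then have "mixed_payoff u p q - c = (\<Sum>y\<in>UNIV. pmf q y *\<^sub>R (mixed_payoff u p (return_pmf y) - c))"
    by (subst mixed_payoff_average_right) (simp add: scaleR_right_diff_distrib sum_subtractf)
  then show ?thesis
    using assms by (simp add: inner_sum_left sum_nonpos mult_nonneg_nonpos)
qed

lemma compact_range_mixed_payoff: "compact (range (\<lambda>p. mixed_payoff u p q))"
proof -
  have "range (\<lambda>p. mixed_payoff u p q) = convex hull (range (\<lambda>x. mixed_payoff u (return_pmf x) q))"
    unfolding convex_hull_range_eq_pmf_averages by (rule image_cong) (rule refl mixed_payoff_average_left)+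
  then show ?thesis by (simp add: finite_imp_compact_convex_hull)
qed

section \<open>The dual condition for convex sets\<close>

text \<open>
  The part of the minimax theorem that is needed here. The vectors \<open>(f(p, y))\<^sub>y\<close> form a polytope; if it
  missed the nonpositive orthant, a separating hyperplane would have a normal with components of one
  sign, and after normalisation this normal would be a mixed action \<open>q\<close> against which no \<open>p\<close> does well.
\<close>

lemma minimax_alternative:
  fixes f :: "'a::finite \<Rightarrow> 'b::finite \<Rightarrow> real"
  assumes "\<And>q :: 'b pmf. \<exists>p :: 'a pmf. (\<Sum>x\<in>UNIV. pmf p x * (\<Sum>y\<in>UNIV. pmf q y * f x y)) \<le> 0"
  shows "\<exists>p :: 'a pmf. \<forall>y. (\<Sum>x\<in>UNIV. pmf p x * f x y) \<le> 0"
proof (rule ccontr)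
  assume no: "\<not> ?thesis"
  define g :: "'a \<Rightarrow> real ^ 'b" where "g x = (\<chi> y. f x y)" for x
  define N :: "(real ^ 'b) set" where "N = {v. \<forall>y. v $ y \<le> 0}"
  have "convex N"
    unfolding N_def by (auto simp: convex_def intro!: add_nonpos_nonpos mult_nonneg_nonpos)
  moreover have "closed N"
    unfolding N_def by (intro closed_Collect_all closed_Collect_le continuous_intros)
  moreover have "convex hull (range g) \<inter> N = {}"
    using no by (fastforce simp: convex_hull_range_eq_pmf_averages N_def g_def)
  ultimately obtain a b where ab: "\<forall>v\<in>convex hull (range g). inner a v < b" "\<forall>v\<in>N. inner a v > b"
    using separating_hyperplane_compact_closed[of "convex hull (range g)" N]
    by (auto simp: finite_imp_compact_convex_hull)
  have "0 \<in> N" by (simp add: N_def)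
  then have "b < 0" using ab(2) by force
  \<comment> \<open>The orthant contains arbitrarily long multiples of each negative unit vector.\<close>
  have a_le: "a $ y \<le> 0" for y
  proof (rule ccontr)
    assume neg: "\<not> a $ y \<le> 0"
    \<comment> \<open>On this point the functional takes exactly the value b.\<close>
    have "axis y (b / a $ y) \<in> N"
      using neg \<open>b < 0\<close> by (auto simp: N_def axis_def divide_nonpos_pos)
    then have "inner a (axis y (b / a $ y)) > b" using ab(2) by blast
    then show False using neg by (simp add: inner_axis)
  qed
  define s where "s = (\<Sum>y\<in>UNIV. - a $ y)"
  have "inner a (g undefined) < 0"
    using ab(1) \<open>b < 0\<close> hull_inc[of "g undefined" "range g" convex] by force
  then have "a \<noteq> 0" by auto
  then obtain y0 where "a $ y0 < 0" using a_le by (metis less_eq_real_def vec_eq_iff zero_index)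
  then have "s > 0" unfolding s_def using a_le by (intro sum_pos2[of _ y0]) auto
  then have "(\<Sum>y\<in>UNIV. - a $ y / s) = 1"
    by (simp only: sum_divide_distrib[symmetric] s_def[symmetric]) simp
  then obtain q :: "'b pmf" where q: "\<And>y. pmf q y = - a $ y / s"
    using ex_pmf_of_weights[of "\<lambda>y. - a $ y / s"] a_le \<open>s > 0\<close>
    by (auto simp: divide_nonpos_pos)
  obtain p :: "'a pmf" where p: "(\<Sum>x\<in>UNIV. pmf p x * (\<Sum>y\<in>UNIV. pmf q y * f x y)) \<le> 0"
    using assms by blast
  have "(\<Sum>x\<in>UNIV. pmf p x *\<^sub>R g x) \<in> convex hull (range g)"
    by (simp add: convex_hull_range_eq_pmf_averages)
  then have "inner a (\<Sum>x\<in>UNIV. pmf p x *\<^sub>R g x) < 0"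
    using ab(1) \<open>b < 0\<close> by force
  moreover have "(\<Sum>y\<in>UNIV. pmf q y * f x y) = - inner a (g x) / s" for x
    by (simp add: q inner_vec_def g_def sum_divide_distrib sum_negf)
  then have "(\<Sum>x\<in>UNIV. pmf p x * (\<Sum>y\<in>UNIV. pmf q y * f x y))
      = - inner a (\<Sum>x\<in>UNIV. pmf p x *\<^sub>R g x) / s"
    by (simp add: inner_sum_right sum_divide_distrib sum_negf)
  ultimately show False using p \<open>s > 0\<close> by (simp add: zero_le_divide_iff)
qed

text \<open>
  Blackwell's dual condition. For convex \<open>C\<close> the nearest point \<open>c\<close> of \<open>z\<close> satisfies
  \<open>\<langle>v - c, z - c\<rangle> \<le> 0\<close> for every \<open>v \<in> C\<close>. A reply to \<open>q\<close> with payoff in \<open>C\<close> therefore lies on the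
  right side of the hyperplane through \<open>c\<close>; the minimax theorem exchanges the quantifiers over \<open>p\<close>
  and \<open>q\<close>.
\<close>

lemma B_set_if_dual_condition:
  assumes C: "C \<noteq> {}" "closed C" "convex C"
    and dual: "\<And>q. \<exists>p. mixed_payoff u p q \<in> C"
  shows "B_set u C"
  unfolding B_set_def
proof (intro conjI allI C)
  fix z
  define c where "c = closest_point C z"
  have near: "c \<in> nearest_points C z"
    using closest_point_exists[OF C(2,1), of z] infdist_attains_inf[OF C(2,1), of z]
      infdist_le[of _ C z]
    unfolding nearest_points_def c_def
    by (metis (mono_tags, lifting) dist_norm mem_Collect_eq order_antisym)
  have ball: "inner (v - c) (z - c) \<le> 0" if "v \<in> C" for v
    using closest_point_dot[OF C(3,2) that, of z] by (simp add: c_def inner_commute)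
  define f where "f x y = inner (u x y - c) (z - c)" for x y
  have bil: "inner (mixed_payoff u p q - c) (z - c) = (\<Sum>x\<in>UNIV. pmf p x * (\<Sum>y\<in>UNIV. pmf q y * f x y))"
    for p q
  proof -
    have "(\<Sum>x\<in>UNIV. pmf p x * (\<Sum>y\<in>UNIV. pmf q y * inner c (z - c))) = inner c (z - c)"
      by (simp add: sum_distrib_right[symmetric] sum_pmf_UNIV)
    then show ?thesis
      by (simp add: f_def mixed_payoff_def inner_diff_left inner_sum_left right_diff_distrib
          sum_subtractf sum_distrib_left mult.assoc)
  qed
  obtain p where p: "\<And>y. (\<Sum>x\<in>UNIV. pmf p x * f x y) \<le> 0"
    using minimax_alternative[of f] bil ball dual by metis
  have "inner (mixed_payoff u p (return_pmf y) - c) (z - c) \<le> 0" for y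
    unfolding bil using p[of y]
    by (simp add: indicator_def of_bool_def if_distrib[of "\<lambda>r. r * _"] cong: if_cong)
  then show "\<exists>c\<in>nearest_points C z. \<exists>x. \<forall>y. inner (mixed_payoff u x (return_pmf y) - c) (z - c) \<le> 0"
    using near by blast
qed


section \<open>Payoffs along pairs of controls\<close>

lemma borel_measurable_control:
  assumes "a \<in> controls" "0 \<le> s"
  shows "(\<lambda>r. pmf (a r) x) \<in> borel_measurable (lebesgue_on {s..t})"
  by (rule measurable_restrict_mono[of _ _ "{0..}"]) (use assms in \<open>auto simp: controls_def\<close>)

lemma set_integrable_bounded_on_Icc:
  fixes f :: "real \<Rightarrow> 'v::euclidean_space"
  assumes "f \<in> borel_measurable (lebesgue_on {s..t})" and "\<And>r. norm (f r) \<le> B"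
  shows "set_integrable lebesgue {s..t} f"
proof -
  have "finite_measure (lebesgue_on {s..t})"
    by (simp add: finite_measure_lebesgue_on)
  then have "integrable (lebesgue_on {s..t}) f"
    by (rule finite_measure.integrable_const_bound[where B = B]) (use assms in auto)
  then show ?thesis
    by (simp add: integrable_restrict_space set_integrable_def)
qed

lemma set_integrable_payoff:
  assumes "a \<in> controls" "b \<in> controls" "0 \<le> s"
  shows "set_integrable lebesgue {s..t} (\<lambda>r. mixed_payoff u (a r) (b r))"
proof (rule set_integrable_bounded_on_Icc)
  show "(\<lambda>r. mixed_payoff u (a r) (b r)) \<in> borel_measurable (lebesgue_on {s..t})"
    unfolding mixed_payoff_def
    by (intro borel_measurable_sum borel_measurable_scaleR borel_measurable_times
        borel_measurable_const borel_measurable_control assms)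
qed (rule norm_mixed_payoff_le)

lemma integrable_on_payoff:
  assumes "a \<in> controls" "b \<in> controls" "0 \<le> s"
  shows "(\<lambda>r. mixed_payoff u (a r) (b r)) integrable_on {s..t}"
  by (rule set_lebesgue_integral_eq_integral(1)[OF set_integrable_payoff[OF assms]])

text \<open>
  The simplex is convex, so the time average of a control over an interval is again a mixed
  action. By bilinearity, playing against a constant action is then worth the same as playing this
  average action throughout.
\<close>

lemma time_average_action:
  assumes a: "a \<in> controls" and "0 \<le> s" "s \<le> t"
  obtains p where "\<And>x. ((\<lambda>r. pmf (a r) x) has_integral (t - s) * pmf p x) {s..t}"
proof (cases "s = t")
  case True
  then show ?thesis by (intro that[of "a s"]) (simp add: has_integral_refl)
next
  case False
  define w where "w x = integral {s..t} (\<lambda>r. pmf (a r) x)" for x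
  have int: "((\<lambda>r. pmf (a r) x) has_integral w x) {s..t}" for x
    unfolding w_def
    by (rule integrable_integral, rule set_lebesgue_integral_eq_integral(1),
        rule set_integrable_bounded_on_Icc[where B = 1])
      (simp_all add: borel_measurable_control a \<open>0 \<le> s\<close> pmf_le_1)
  have "((\<lambda>r. \<Sum>x\<in>UNIV. pmf (a r) x) has_integral (\<Sum>x\<in>UNIV. w x)) {s..t}"
    by (intro has_integral_sum int) simp
  then have "((\<lambda>r. 1) has_integral (\<Sum>x\<in>UNIV. w x)) {s..t}"
    by (simp add: sum_pmf_UNIV)
  then have "(\<Sum>x\<in>UNIV. w x) = t - s"
    by (rule has_integral_unique) (use has_integral_const_real[of "1::real" s t] \<open>s \<le> t\<close> in simp)
  moreover have "0 \<le> w x" for x using int by (rule has_integral_nonneg) simp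
  ultimately obtain p where "\<And>x. pmf p x = w x / (t - s)"
    using ex_pmf_of_weights[of "\<lambda>x. w x / (t - s)"] False \<open>s \<le> t\<close>
    by (auto simp: sum_divide_distrib[symmetric])
  then show ?thesis using that[of p] int False by simp
qed

lemma payoff_against_constant_right:
  assumes "a \<in> controls" "0 \<le> s" "s \<le> t" and b: "\<And>r. r \<in> {s..<t} \<Longrightarrow> b r = q"
  shows "\<exists>p. integral {s..t} (\<lambda>r. mixed_payoff u (a r) (b r)) = (t - s) *\<^sub>R mixed_payoff u p q"
proof -
  obtain p where p: "\<And>x. ((\<lambda>r. pmf (a r) x) has_integral (t - s) * pmf p x) {s..t}"
    using time_average_action[OF assms(1-3)] by blast
  have "((\<lambda>r. \<Sum>x\<in>UNIV. pmf (a r) x *\<^sub>R mixed_payoff u (return_pmf x) q) has_integral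
      (\<Sum>x\<in>UNIV. ((t - s) * pmf p x) *\<^sub>R mixed_payoff u (return_pmf x) q)) {s..t}"
    by (intro has_integral_sum has_integral_scaleR_left p) simp
  then have "((\<lambda>r. mixed_payoff u (a r) q) has_integral (t - s) *\<^sub>R mixed_payoff u p q) {s..t}"
    by (simp add: mixed_payoff_average_left[symmetric] scaleR_scaleR[symmetric] scaleR_right.sum[symmetric]
        del: scaleR_scaleR)
  then have "((\<lambda>r. mixed_payoff u (a r) (b r)) has_integral (t - s) *\<^sub>R mixed_payoff u p q) {s..t}"
    by (rule has_integral_spike_finite[of "{t}", rotated 2]) (use b in auto)
  then show ?thesis by (metis integral_unique)
qed

text \<open>
  The action at the right end point is left free, because a block strategy fixes the action only on
  half-open blocks, while integrals are taken over closed ones.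
\<close>
lemma payoff_against_constant_left:
  assumes "b \<in> controls" "0 \<le> s" "s \<le> t" and a: "\<And>r. r \<in> {s..<t} \<Longrightarrow> a r = p"
  shows "\<exists>q. integral {s..t} (\<lambda>r. mixed_payoff u (a r) (b r)) = (t - s) *\<^sub>R mixed_payoff u p q"
proof -
  obtain q where q: "\<And>y. ((\<lambda>r. pmf (b r) y) has_integral (t - s) * pmf q y) {s..t}"
    using time_average_action[OF assms(1-3)] by blast
  have "((\<lambda>r. \<Sum>y\<in>UNIV. pmf (b r) y *\<^sub>R mixed_payoff u p (return_pmf y)) has_integral
      (\<Sum>y\<in>UNIV. ((t - s) * pmf q y) *\<^sub>R mixed_payoff u p (return_pmf y))) {s..t}"
    by (intro has_integral_sum has_integral_scaleR_left q) simp
  then have "((\<lambda>r. mixed_payoff u p (b r)) has_integral (t - s) *\<^sub>R mixed_payoff u p q) {s..t}"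
    by (simp add: mixed_payoff_average_right[symmetric] scaleR_scaleR[symmetric] scaleR_right.sum[symmetric]
        del: scaleR_scaleR)
  then have "((\<lambda>r. mixed_payoff u (a r) (b r)) has_integral (t - s) *\<^sub>R mixed_payoff u p q) {s..t}"
    by (rule has_integral_spike_finite[of "{t}", rotated 2]) (use a in auto)
  then show ?thesis by (metis integral_unique)
qed

lemma cumulative_payoff_along_play_path:
  assumes "\<sigma>1 \<in> strategies" "\<sigma>2 \<in> strategies"
  obtains a b where "a \<in> controls" "b \<in> controls" "\<sigma>1 b = a" "\<sigma>2 a = b"
    "\<And>t. cumulative_payoff u \<sigma>1 \<sigma>2 t = integral {0..t} (\<lambda>r. mixed_payoff u (a r) (b r))"
proof -
  have "is_play_path \<sigma>1 \<sigma>2 (play_path \<sigma>1 \<sigma>2)"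
    unfolding play_path_def by (rule theI'[OF ex1_play_path[OF assms]])
  then have path: "fst (play_path \<sigma>1 \<sigma>2) \<in> controls" "snd (play_path \<sigma>1 \<sigma>2) \<in> controls"
    "\<sigma>1 (snd (play_path \<sigma>1 \<sigma>2)) = fst (play_path \<sigma>1 \<sigma>2)"
    "\<sigma>2 (fst (play_path \<sigma>1 \<sigma>2)) = snd (play_path \<sigma>1 \<sigma>2)"
    by (auto simp: is_play_path_def)
  show thesis
    by (rule that[OF path])
      (simp add: cumulative_payoff_def set_lebesgue_integral_eq_integral(2) set_integrable_payoff path)
qed

lemma constant_strategy: "(\<lambda>_. restrict (\<lambda>_. q) {0..}) \<in> strategies"
proof -
  have "strict_mono (real :: nat \<Rightarrow> real)" by (simp add: strict_mono_def)
  then show ?thesis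
    unfolding strategies_def using const_in_controls filterlim_real_sequentially
    by (intro CollectI conjI funcsetI exI[of _ real]) auto
qed

section \<open>Necessity: constant opponents and the recession cone\<close>

text \<open>
  Player 2 may always repeat \<open>q\<close>; a strategy that keeps the payoff near the target at time \<open>t\<close>
  yields, by averaging, a single mixed action whose payoff is that close after scaling by \<open>t\<close>.
\<close>

lemma mixed_payoff_near_target:
  assumes \<sigma>1: "\<sigma>1 \<in> strategies" and "0 \<le> t"
    and near: "\<And>\<sigma>2. \<sigma>2 \<in> strategies \<Longrightarrow> infdist (cumulative_payoff u \<sigma>1 \<sigma>2 t) Y \<le> \<epsilon>"
  shows "\<exists>p. infdist (t *\<^sub>R mixed_payoff u p q) Y \<le> \<epsilon>"
proof -
  let ?\<sigma>2 = "\<lambda>_. restrict (\<lambda>_. q) {0..}"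
  obtain a b where ab: "a \<in> controls" "b \<in> controls" "\<sigma>1 b = a" "?\<sigma>2 a = b"
    and pay: "\<And>t. cumulative_payoff u \<sigma>1 ?\<sigma>2 t = integral {0..t} (\<lambda>r. mixed_payoff u (a r) (b r))"
    by (rule cumulative_payoff_along_play_path[OF \<sigma>1 constant_strategy[of q], of u]) (rule that)
  have "b r = q" if "r \<in> {0..<t}" for r using ab(4) that by auto
  then obtain p where "cumulative_payoff u \<sigma>1 ?\<sigma>2 t = t *\<^sub>R mixed_payoff u p q"
    using payoff_against_constant_right[OF ab(1), of 0 t b q u] \<open>0 \<le> t\<close> by (auto simp: pay)
  then show ?thesis using near[OF constant_strategy[of q]] by (intro exI[of _ p]) simp
qed

definition recession_cone :: "'v::real_vector set \<Rightarrow> 'v set" where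
  "recession_cone Y = {v. \<forall>y\<in>Y. \<forall>\<beta>\<ge>0. y + \<beta> *\<^sub>R v \<in> Y}"

lemma closed_recession_cone:
  fixes Y :: "'v::real_normed_vector set"
  assumes "closed Y"
  shows "closed (recession_cone Y)"
proof -
  have "recession_cone Y = (\<Inter>y\<in>Y. \<Inter>\<beta>\<in>{0..}. (\<lambda>v. y + \<beta> *\<^sub>R v) -` Y)"
    by (auto simp: recession_cone_def)
  then show ?thesis
    by (auto intro!: closed_INT closed_vimage assms continuous_intros)
qed

lemma convex_recession_cone:
  assumes "convex Y"
  shows "convex (recession_cone Y)"
proof (rule convexI)
  fix v w and a b :: real
  assume vw: "v \<in> recession_cone Y" "w \<in> recession_cone Y" and ab: "0 \<le> a" "0 \<le> b" "a + b = 1"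
  have "y + \<beta> *\<^sub>R (a *\<^sub>R v + b *\<^sub>R w) \<in> Y" if "y \<in> Y" "\<beta> \<ge> 0" for y \<beta>
  proof -
    have "y + \<beta> *\<^sub>R (a *\<^sub>R v + b *\<^sub>R w) = a *\<^sub>R (y + \<beta> *\<^sub>R v) + b *\<^sub>R (y + \<beta> *\<^sub>R w)"
      using scaleR_left_distrib[of a b y] ab(3) by (simp add: algebra_simps)
    also have "\<dots> \<in> Y"
      using vw that ab by (intro convexD[OF assms]) (auto simp: recession_cone_def)
    finally show ?thesis .
  qed
  then show "a *\<^sub>R v + b *\<^sub>R w \<in> recession_cone Y" by (simp add: recession_cone_def)
qed

text \<open>
  The segment from \<open>x\<close> to a far point \<open>y n\<close> stays in \<open>Y\<close>, and its point at parameter \<open>\<beta> / s n\<close>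
  converges to \<open>x + \<beta> v\<close>.
\<close>

lemma asymptotic_direction_in_recession_cone:
  fixes Y :: "'v::real_normed_vector set"
  assumes Y: "closed Y" "convex Y"
    and s: "filterlim s at_top sequentially" and "\<And>n. y n \<in> Y"
    and lim: "(\<lambda>n. y n /\<^sub>R s n) \<longlonglongrightarrow> v"
  shows "v \<in> recession_cone Y"
  unfolding recession_cone_def
proof (intro CollectI ballI allI impI)
  fix x and \<beta> :: real
  assume x: "x \<in> Y" and \<beta>: "\<beta> \<ge> 0"
  have "(\<lambda>n. \<beta> / s n) \<longlonglongrightarrow> 0"
    by (rule tendsto_divide_0[OF tendsto_const filterlim_at_top_imp_at_infinity[OF s]])
  then have "(\<lambda>n. (1 - \<beta> / s n) *\<^sub>R x + \<beta> *\<^sub>R (y n /\<^sub>R s n)) \<longlonglongrightarrow> (1 - 0) *\<^sub>R x + \<beta> *\<^sub>R v"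
    by (intro tendsto_intros lim)
  moreover have "\<forall>\<^sub>F n in sequentially. max \<beta> 1 \<le> s n"
    using s unfolding filterlim_at_top by blast
  then have "\<forall>\<^sub>F n in sequentially. (1 - \<beta> / s n) *\<^sub>R x + \<beta> *\<^sub>R (y n /\<^sub>R s n) \<in> Y"
  proof eventually_elim
    case (elim n)
    have "(1 - \<beta> / s n) *\<^sub>R x + (\<beta> / s n) *\<^sub>R y n \<in> Y"
      using elim \<beta> x assms(4) by (intro convexD[OF Y(2)]) (auto simp: divide_le_eq_1)
    then show ?case by (simp add: divide_inverse)
  qed
  ultimately show "x + \<beta> *\<^sub>R v \<in> Y"
    using Lim_in_closed_set[OF Y(1)] by fastforce
qed

text \<open>
  Against a constant action \<open>q\<close>, the time \<open>T\<close> gives replies with \<open>T u(p, q)\<close> arbitrarily close to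
  \<open>Y\<close>, hence, by compactness, one in \<open>Y\<close>. Late times \<open>s n\<close> give replies within distance \<open>1\<close> of \<open>Y\<close>
  after scaling by \<open>s n\<close>; their limits are asymptotic directions of \<open>Y\<close>. So both sets satisfy the
  dual condition. That \<open>T\<close> is independent of \<open>\<epsilon>\<close> is essential in the first case.
\<close>

lemma B_sets_if_attainable:
  assumes att: "attainable u Y" and Y: "closed Y" "convex Y"
  obtains T where "T > 0" "B_set u ((\<lambda>y. y /\<^sub>R T) ` Y)" "B_set u (recession_cone Y)"
proof -
  obtain T where T: "T > 0" and "Y \<noteq> {}"
    and near: "\<And>\<epsilon>. \<epsilon> > 0 \<Longrightarrow> \<exists>\<sigma>1\<in>strategies. \<forall>t\<ge>T. \<forall>\<sigma>2\<in>strategies.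
        infdist (cumulative_payoff u \<sigma>1 \<sigma>2 t) Y \<le> \<epsilon>"
    using att unfolding attainable_def by blast
  have nearp: "\<exists>p. infdist (t *\<^sub>R mixed_payoff u p q) Y \<le> \<epsilon>" if \<epsilon>: "\<epsilon> > 0" and t: "t \<ge> T" for \<epsilon> t q
  proof -
    obtain \<sigma>1 where "\<sigma>1 \<in> strategies"
      "\<And>t \<sigma>2. t \<ge> T \<Longrightarrow> \<sigma>2 \<in> strategies \<Longrightarrow> infdist (cumulative_payoff u \<sigma>1 \<sigma>2 t) Y \<le> \<epsilon>"
      using near[OF \<epsilon>] by blast
    then show ?thesis using mixed_payoff_near_target[of \<sigma>1 t u Y \<epsilon> q] t T by simp
  qed
  have "B_set u ((\<lambda>y. y /\<^sub>R T) ` Y)"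
  proof (rule B_set_if_dual_condition)
    fix q
    define f where "f v = infdist (T *\<^sub>R v) Y" for v
    have "continuous_on (range (\<lambda>p. mixed_payoff u p q)) f"
      unfolding f_def by (intro continuous_intros)
    then obtain p where p: "\<And>p'. f (mixed_payoff u p q) \<le> f (mixed_payoff u p' q)"
      using continuous_attains_inf[OF compact_range_mixed_payoff[of u q]] by blast
    have "f (mixed_payoff u p q) \<le> \<epsilon>" if "\<epsilon> > 0" for \<epsilon>
      using nearp[OF that order_refl, of q] order_trans[OF p] unfolding f_def by blast
    then have "f (mixed_payoff u p q) \<le> 0" by (rule field_le_epsilon[of _ 0, simplified])
    then have "infdist (T *\<^sub>R mixed_payoff u p q) Y = 0"
      unfolding f_def using infdist_nonneg by (metis order_antisym)
    then have "T *\<^sub>R mixed_payoff u p q \<in> Y"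
      using Y(1) \<open>Y \<noteq> {}\<close> by (simp add: in_closed_iff_infdist_zero)
    then have "(T *\<^sub>R mixed_payoff u p q) /\<^sub>R T \<in> (\<lambda>y. y /\<^sub>R T) ` Y" by (rule imageI)
    then show "\<exists>p. mixed_payoff u p q \<in> (\<lambda>y. y /\<^sub>R T) ` Y" using T by auto
  qed (use \<open>Y \<noteq> {}\<close> Y in \<open>auto intro: closed_scaling convex_scaling\<close>)
  moreover have "B_set u (recession_cone Y)"
  proof (rule B_set_if_dual_condition)
    show "recession_cone Y \<noteq> {}" by (auto simp: recession_cone_def intro!: exI[of _ 0])
    fix q
    define s where "s n = T + real n" for n
    have "\<exists>p. infdist (s n *\<^sub>R mixed_payoff u p q) Y \<le> 1" for n
      using nearp[of 1 "s n" q] T by (simp add: s_def)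
    then obtain p where p: "\<And>n. infdist (s n *\<^sub>R mixed_payoff u (p n) q) Y \<le> 1" by metis
    have "\<exists>y\<in>Y. dist (s n *\<^sub>R mixed_payoff u (p n) q) y \<le> 1" for n
    proof -
      obtain y where "y \<in> Y" "infdist (s n *\<^sub>R mixed_payoff u (p n) q) Y = dist (s n *\<^sub>R mixed_payoff u (p n) q) y"
        by (rule infdist_attains_inf[OF Y(1) \<open>Y \<noteq> {}\<close>])
      then show ?thesis using p[of n] by auto
    qed
    then obtain y where y: "\<And>n. y n \<in> Y" "\<And>n. dist (s n *\<^sub>R mixed_payoff u (p n) q) (y n) \<le> 1"
      by metis
    have "\<forall>n. mixed_payoff u (p n) q \<in> range (\<lambda>p. mixed_payoff u p q)" by simp
    then obtain l r where l: "l \<in> range (\<lambda>p. mixed_payoff u p q)" and r: "strict_mono (r :: nat \<Rightarrow> nat)"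
      and lim: "((\<lambda>n. mixed_payoff u (p n) q) \<circ> r) \<longlonglongrightarrow> l"
      using compact_range_mixed_payoff[of u q] unfolding compact_eq_seq_compact_metric seq_compact_def
      by (elim allE[of _ "\<lambda>n. mixed_payoff u (p n) q"]) blast
    have s_top: "filterlim s at_top sequentially"
      unfolding s_def by (intro filterlim_tendsto_add_at_top[OF tendsto_const] filterlim_real_sequentially)
    then have sr: "filterlim (s \<circ> r) at_top sequentially"
      unfolding comp_def by (rule filterlim_compose) (rule filterlim_subseq[OF r])
    have s_pos: "s n > 0" for n using T by (simp add: s_def)
    have gap: "norm (mixed_payoff u (p n) q - y n /\<^sub>R s n) \<le> inverse (s n)" for n
    proof -
      have "mixed_payoff u (p n) q - y n /\<^sub>R s n = (s n *\<^sub>R mixed_payoff u (p n) q - y n) /\<^sub>R s n"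
        using s_pos[of n] by (simp add: scaleR_right_diff_distrib)
      then show ?thesis
        using y(2)[of n] s_pos[of n] by (simp add: dist_norm mult_left_le)
    qed
    have "(\<lambda>n. inverse (s (r n))) \<longlonglongrightarrow> 0"
      using tendsto_inverse_0_at_top[OF sr] by (simp add: comp_def)
    then have "(\<lambda>n. mixed_payoff u (p (r n)) q - y (r n) /\<^sub>R s (r n)) \<longlonglongrightarrow> 0"
      by (rule Lim_null_comparison[OF always_eventually, rotated]) (intro allI gap)
    then have "(\<lambda>n. y (r n) /\<^sub>R s (r n)) \<longlonglongrightarrow> l"
      using tendsto_diff[OF lim[unfolded comp_def]] by fastforce
    then have "l \<in> recession_cone Y"
      using asymptotic_direction_in_recession_cone[OF Y sr, of "y \<circ> r" l] y(1) by (simp add: comp_def)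
    then show "\<exists>p. mixed_payoff u p q \<in> recession_cone Y" using l by auto
  qed (use Y in \<open>auto intro: closed_recession_cone convex_recession_cone\<close>)
  ultimately show thesis using that T by blast
qed


section \<open>Block strategies\<close>

definition time_grid :: "(nat \<Rightarrow> real) \<Rightarrow> bool" where
  "time_grid \<tau> \<longleftrightarrow> \<tau> 0 = 0 \<and> strict_mono \<tau> \<and> filterlim \<tau> at_top sequentially"

text \<open>
  A block strategy keeps its action fixed between two consecutive times of a grid. The action is
  chosen from the list of the payoffs collected in the completed blocks. This list determines
  Player 1's own past actions, so it can be computed from the opponent's control alone by recursion.
\<close>

primrec block_payoffs ::
    "('a::finite \<Rightarrow> 'b::finite \<Rightarrow> real ^ 'm) \<Rightarrow> (nat \<Rightarrow> real) \<Rightarrow> ((real ^ 'm) list \<Rightarrow> 'a pmf) \<Rightarrow>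
     (real \<Rightarrow> 'b pmf) \<Rightarrow> nat \<Rightarrow> (real ^ 'm) list" where
  "block_payoffs u \<tau> sel b 0 = []"
| "block_payoffs u \<tau> sel b (Suc k) = block_payoffs u \<tau> sel b k @
     [integral {\<tau> k..\<tau> (Suc k)} (\<lambda>r. mixed_payoff u (sel (block_payoffs u \<tau> sel b k)) (b r))]"

definition block_strategy ::
    "('a::finite \<Rightarrow> 'b::finite \<Rightarrow> real ^ 'm) \<Rightarrow> (nat \<Rightarrow> real) \<Rightarrow> ((real ^ 'm) list \<Rightarrow> 'a pmf) \<Rightarrow>
     (real \<Rightarrow> 'b pmf) \<Rightarrow> real \<Rightarrow> 'a pmf" where
  "block_strategy u \<tau> sel b =
     restrict (\<lambda>t. sel (block_payoffs u \<tau> sel b (LEAST k. t < \<tau> (Suc k)))) {0..}"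

lemma length_block_payoffs [simp]: "length (block_payoffs u \<tau> sel b k) = k"
  by (induction k) auto

lemma time_grid_nonneg: "time_grid \<tau> \<Longrightarrow> 0 \<le> \<tau> k"
  unfolding time_grid_def by (metis strict_mono_less_eq zero_le)

lemma block_strategy_on_block:
  assumes "time_grid \<tau>" "\<tau> k \<le> t" "t < \<tau> (Suc k)"
  shows "block_strategy u \<tau> sel b t = sel (block_payoffs u \<tau> sel b k)"
proof -
  have "(LEAST k. t < \<tau> (Suc k)) = k"
  proof (rule Least_equality)
    fix j assume "t < \<tau> (Suc j)"
    then have "\<tau> k < \<tau> (Suc j)" using assms(2) by simp
    then show "k \<le> j"
      using assms(1) by (simp add: time_grid_def strict_mono_less)
  qed (rule assms(3))
  moreover have "0 \<le> t" using time_grid_nonneg[OF assms(1), of k] assms(2) by simp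
  ultimately show ?thesis by (simp add: block_strategy_def)
qed

lemma block_strategy_in_controls: "block_strategy u \<tau> sel b \<in> controls"
proof -
  have "(\<lambda>t. LEAST k. t < \<tau> (Suc k)) \<in> borel \<rightarrow>\<^sub>M count_space UNIV"
    by measurable
  then have "(\<lambda>t. f (LEAST k. t < \<tau> (Suc k))) \<in> borel_measurable borel" for f :: "nat \<Rightarrow> real"
    by (rule measurable_compose) simp
  then have meas: "(\<lambda>t. f (LEAST k. t < \<tau> (Suc k))) \<in> borel_measurable (lebesgue_on {0..})"
    for f :: "nat \<Rightarrow> real"
    by (intro measurable_restrict_space1 measurable_completion) simp
  have "(\<lambda>t. pmf (block_strategy u \<tau> sel b t) x) \<in> borel_measurable (lebesgue_on {0..})" for x
    by (subst measurable_cong[where g = "\<lambda>t. pmf (sel (block_payoffs u \<tau> sel b (LEAST k. t < \<tau> (Suc k)))) x"])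
      (use meas in \<open>auto simp: block_strategy_def\<close>)
  then show ?thesis by (auto simp: controls_def block_strategy_def)
qed

lemma block_payoffs_cong:
  assumes grid: "time_grid \<tau>" and eq: "\<And>t. t \<in> {0..<\<tau> k} \<Longrightarrow> b t = b' t"
  shows "block_payoffs u \<tau> sel b k = block_payoffs u \<tau> sel b' k"
  using eq
proof (induction k)
  case (Suc k)
  have "\<tau> k < \<tau> (Suc k)" using grid by (simp add: time_grid_def strict_mono_less)
  then have IH: "block_payoffs u \<tau> sel b k = block_payoffs u \<tau> sel b' k"
    using Suc by auto
  have "integral {\<tau> k..\<tau> (Suc k)} (\<lambda>r. mixed_payoff u (sel (block_payoffs u \<tau> sel b' k)) (b r)) =
      integral {\<tau> k..\<tau> (Suc k)} (\<lambda>r. mixed_payoff u (sel (block_payoffs u \<tau> sel b' k)) (b' r))"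
  proof (rule integral_spike[of "{\<tau> (Suc k)}"])
    fix r assume "r \<in> {\<tau> k..\<tau> (Suc k)} - {\<tau> (Suc k)}"
    then have "b r = b' r" using Suc.prems[of r] time_grid_nonneg[OF grid, of k] by auto
    then show "mixed_payoff u (sel (block_payoffs u \<tau> sel b' k)) (b' r) =
        mixed_payoff u (sel (block_payoffs u \<tau> sel b' k)) (b r)" by simp
  qed simp
  then show ?case using IH by simp
qed simp

lemma block_strategy_in_strategies:
  assumes grid: "time_grid \<tau>"
  shows "block_strategy u \<tau> sel \<in> strategies"
proof -
  have "block_strategy u \<tau> sel b t = block_strategy u \<tau> sel b' t"
    if "\<forall>t\<in>{0..<\<tau> k}. b t = b' t" "t \<in> {\<tau> k..<\<tau> (Suc k)}" for b b' k t
    using block_payoffs_cong[OF grid, of k b b' u sel] block_strategy_on_block[OF grid, of k t u sel] that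
    by auto
  then show ?thesis
    using grid unfolding strategies_def time_grid_def
    by (intro CollectI conjI funcsetI block_strategy_in_controls exI[of _ \<tau>]) blast+
qed

text \<open>
  The recursion above indeed records the payoffs along the pair of controls that results when the
  opponent uses \<open>b\<close>.
\<close>

lemma sum_list_drop_block_payoffs:
  assumes grid: "time_grid \<tau>" and b: "b \<in> controls" and "N \<le> k"
  shows "sum_list (drop N (block_payoffs u \<tau> sel b k)) =
    integral {\<tau> N..\<tau> k} (\<lambda>r. mixed_payoff u (block_strategy u \<tau> sel b r) (b r))"
  using \<open>N \<le> k\<close>
proof (induction k rule: dec_induct)
  case base
  then show ?case by simp
next
  case (step k)
  let ?f = "\<lambda>r. mixed_payoff u (block_strategy u \<tau> sel b r) (b r)"
  have mono: "\<tau> N \<le> \<tau> k" "\<tau> k \<le> \<tau> (Suc k)"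
    using grid step.hyps by (simp_all add: time_grid_def strict_mono_less_eq)
  have "integral {\<tau> k..\<tau> (Suc k)} (\<lambda>r. mixed_payoff u (sel (block_payoffs u \<tau> sel b k)) (b r)) =
      integral {\<tau> k..\<tau> (Suc k)} ?f"
    by (rule integral_spike[of "{\<tau> (Suc k)}"])
      (auto simp: block_strategy_on_block[OF grid, of k])
  moreover have "integral {\<tau> N..\<tau> k} ?f + integral {\<tau> k..\<tau> (Suc k)} ?f = integral {\<tau> N..\<tau> (Suc k)} ?f"
    using mono by (intro Henstock_Kurzweil_Integration.integral_combine integrable_on_payoff
        block_strategy_in_controls b time_grid_nonneg[OF grid])
  ultimately show ?case using step by simp
qed

section \<open>Blackwell's estimate\<close>

text \<open>
  Blackwell's geometric argument, with time weights. Write \<open>y = t z\<close> and let \<open>c'\<close> be the nearest point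
  of \<open>z\<close> from the \<open>B\<close>-set condition. Replacing \<open>c\<close> by \<open>c'\<close> does not increase the distance, and
  playing the action \<open>\<xi> z\<close> for a time \<open>h\<close> adds to \<open>y - t c'\<close> the vector
  \<open>h (u - c')\<close>, which makes an angle of at least 90 degrees with it. So only a second order term enters
  the squared distance. The constant \<open>K\<close> bounds \<open>u - c'\<close>; it is uniform because \<open>z\<close> is an average
  payoff and hence bounded. At \<open>t = 0\<close> the convention \<open>y / 0 = 0\<close> does no harm, since then \<open>y = 0\<close>.
\<close>

lemma B_set_step:
  fixes u :: "'a::finite \<Rightarrow> 'b::finite \<Rightarrow> real ^ 'm"
  assumes "B_set u C"
  defines "M \<equiv> \<Sum>x\<in>UNIV. \<Sum>y\<in>UNIV. norm (u x y)"
  obtains \<xi> K where "K \<ge> 0"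
    "\<And>t y E c h q. \<lbrakk>0 \<le> t; 0 \<le> h; norm y \<le> M * t; c \<in> C; (norm (y - t *\<^sub>R c))\<^sup>2 \<le> E\<rbrakk> \<Longrightarrow>
       \<exists>c'\<in>C. (norm (y + h *\<^sub>R mixed_payoff u (\<xi> (y /\<^sub>R t)) q - (t + h) *\<^sub>R c'))\<^sup>2 \<le> E + h\<^sup>2 * K\<^sup>2"
proof -
  have C: "C \<noteq> {}" "\<forall>z. \<exists>x. \<exists>c\<in>nearest_points C z. \<forall>y.
      inner (mixed_payoff u x (return_pmf y) - c) (z - c) \<le> 0"
    using assms(1) unfolding B_set_def by blast+
  obtain \<xi> where \<xi>: "\<And>z. \<exists>c\<in>nearest_points C z. \<forall>y.
      inner (mixed_payoff u (\<xi> z) (return_pmf y) - c) (z - c) \<le> 0"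
    using choice[OF C(2)] by blast
  obtain c0 where c0: "c0 \<in> C" using C(1) by blast
  have "M \<ge> 0" unfolding M_def by (intro sum_nonneg) simp
  define K where "K = 3 * M + norm c0"
  show thesis
  proof (rule that[of K \<xi>])
    show "K \<ge> 0" using \<open>M \<ge> 0\<close> by (simp add: K_def)
    fix t E h :: real and y c :: "real ^ 'm" and q :: "'b pmf"
    assume t: "0 \<le> t" and h: "0 \<le> h" and y: "norm y \<le> M * t" and c: "c \<in> C"
      and E: "(norm (y - t *\<^sub>R c))\<^sup>2 \<le> E"
    define z where "z = y /\<^sub>R t"
    have yz: "y = t *\<^sub>R z" using y t by (cases "t = 0") (auto simp: z_def)
    have z: "norm z \<le> M"
    proof (cases "t = 0")
      case False
      then show ?thesis using y t by (simp add: z_def field_simps)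
    qed (use \<open>M \<ge> 0\<close> in \<open>simp add: z_def\<close>)
    obtain c' where c': "c' \<in> nearest_points C z"
      and half: "\<And>y. inner (mixed_payoff u (\<xi> z) (return_pmf y) - c') (z - c') \<le> 0"
      using \<xi>[of z] by blast
    let ?v = "mixed_payoff u (\<xi> z) q"
    have near: "c' \<in> C" "norm (z - c') \<le> norm (z - d)" if "d \<in> C" for d
      using c' infdist_le[OF that, of z] by (auto simp: nearest_points_def dist_norm)
    have "norm (z - c') \<le> M + norm c0"
      using near(2)[OF c0] z norm_triangle_ineq4[of z c0] by linarith
    then have "norm c' \<le> 2 * M + norm c0"
      using z norm_triangle_ineq4[of z "z - c'"] by simp
    then have diam: "norm (?v - c') \<le> K"
      using norm_mixed_payoff_le[of u "\<xi> z" q] norm_triangle_ineq4[of ?v c'] by (simp add: K_def M_def)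
    have shrink: "(norm (y - t *\<^sub>R c'))\<^sup>2 \<le> E"
    proof -
      have "norm (y - t *\<^sub>R d) = t * norm (z - d)" for d
        using t by (simp add: yz scaleR_right_diff_distrib[symmetric])
      then have "norm (y - t *\<^sub>R c') \<le> norm (y - t *\<^sub>R c)"
        using near(2)[OF c] t by (simp add: mult_left_mono)
      then have "(norm (y - t *\<^sub>R c'))\<^sup>2 \<le> (norm (y - t *\<^sub>R c))\<^sup>2" by (intro power_mono) auto
      then show ?thesis using E by (rule order_trans)
    qed
    have "inner (?v - c') (z - c') \<le> 0" by (rule inner_mixed_payoff_le[OF half])
    then have obtuse: "inner (y - t *\<^sub>R c') (h *\<^sub>R (?v - c')) \<le> 0"
      using t h by (simp add: yz scaleR_right_diff_distrib[symmetric] inner_commute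
          mult_nonneg_nonpos)
    have pythagoras: "(norm (d + e))\<^sup>2 \<le> (norm d)\<^sup>2 + (norm e)\<^sup>2" if "inner d e \<le> 0" for d e :: "real ^ 'm"
      using that by (simp add: power2_norm_eq_inner inner_add_left inner_add_right inner_commute)
    have "y + h *\<^sub>R ?v - (t + h) *\<^sub>R c' = (y - t *\<^sub>R c') + h *\<^sub>R (?v - c')"
      by (simp add: algebra_simps)
    then have "(norm (y + h *\<^sub>R ?v - (t + h) *\<^sub>R c'))\<^sup>2 \<le>
        (norm (y - t *\<^sub>R c'))\<^sup>2 + (norm (h *\<^sub>R (?v - c')))\<^sup>2"
      using pythagoras[OF obtuse] by (simp only:)
    also have "\<dots> \<le> E + h\<^sup>2 * K\<^sup>2"
      using shrink diam h by (intro add_mono) (auto simp: power_mult_distrib intro!: mult_left_mono power_mono)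
    finally show "\<exists>c'\<in>C. (norm (y + h *\<^sub>R mixed_payoff u (\<xi> (y /\<^sub>R t)) q - (t + h) *\<^sub>R c'))\<^sup>2
        \<le> E + h\<^sup>2 * K\<^sup>2"
      using near(1)[OF c0] unfolding z_def by blast
  qed
qed

text \<open>
  \<open>S j\<close> is the payoff accumulated in \<open>j\<close> steps that end at the times \<open>t j\<close>. In each step Player 1 plays
  \<open>\<xi>\<close> of the average so far and Player 2's average action \<open>q\<close> is arbitrary.
\<close>

definition tracks ::
    "('a::finite \<Rightarrow> 'b::finite \<Rightarrow> real ^ 'm) \<Rightarrow> (real ^ 'm) set \<Rightarrow> (real ^ 'm \<Rightarrow> 'a pmf) \<Rightarrow> real \<Rightarrow> bool" where
  "tracks u C \<xi> K \<longleftrightarrow> 0 \<le> K \<and>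
     (\<forall>S t. S 0 = 0 \<longrightarrow> t 0 = 0 \<longrightarrow> (\<forall>j. t j \<le> t (Suc j)) \<longrightarrow>
       (\<forall>j. \<exists>q. S (Suc j) = S j + (t (Suc j) - t j) *\<^sub>R mixed_payoff u (\<xi> (S j /\<^sub>R t j)) q) \<longrightarrow>
       (\<forall>j. \<exists>c\<in>C. (norm (S j - t j *\<^sub>R c))\<^sup>2 \<le> (\<Sum>i<j. (t (Suc i) - t i)\<^sup>2) * K\<^sup>2))"

lemma B_set_tracking:
  fixes u :: "'a::finite \<Rightarrow> 'b::finite \<Rightarrow> real ^ 'm"
  assumes "B_set u C"
  shows "\<exists>\<xi> K. tracks u C \<xi> K"
proof -
  define M where "M = (\<Sum>x\<in>UNIV. \<Sum>y\<in>UNIV. norm (u x y))"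
  obtain \<xi> K where K: "K \<ge> 0"
    and step: "\<And>t y E c h q. \<lbrakk>0 \<le> t; 0 \<le> h; norm y \<le> M * t; c \<in> C; (norm (y - t *\<^sub>R c))\<^sup>2 \<le> E\<rbrakk> \<Longrightarrow>
       \<exists>c'\<in>C. (norm (y + h *\<^sub>R mixed_payoff u (\<xi> (y /\<^sub>R t)) q - (t + h) *\<^sub>R c'))\<^sup>2 \<le> E + h\<^sup>2 * K\<^sup>2"
    by (rule B_set_step[OF assms, folded M_def]) (rule that)
  have "tracks u C \<xi> K"
    unfolding tracks_def
  proof (intro conjI allI impI K)
    fix S :: "nat \<Rightarrow> real ^ 'm" and t j
    assume S0: "S 0 = 0" and t0: "t 0 = 0" and t: "\<forall>j. t j \<le> t (Suc j)"
      and S: "\<forall>j. \<exists>q. S (Suc j) = S j + (t (Suc j) - t j) *\<^sub>R mixed_payoff u (\<xi> (S j /\<^sub>R t j)) q"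
    have "0 \<le> t j \<and> norm (S j) \<le> M * t j \<and>
        (\<exists>c\<in>C. (norm (S j - t j *\<^sub>R c))\<^sup>2 \<le> (\<Sum>i<j. (t (Suc i) - t i)\<^sup>2) * K\<^sup>2)" for j
    proof (induction j)
      case 0
      then show ?case using assms by (auto simp: S0 t0 B_set_def)
    next
      case (Suc j)
      define h where "h = t (Suc j) - t j"
      have h: "0 \<le> h" "t (Suc j) = t j + h" using t by (simp_all add: h_def)
      obtain q where q: "S (Suc j) = S j + h *\<^sub>R mixed_payoff u (\<xi> (S j /\<^sub>R t j)) q"
        using S unfolding h_def by blast
      obtain c where c: "c \<in> C" "(norm (S j - t j *\<^sub>R c))\<^sup>2 \<le> (\<Sum>i<j. (t (Suc i) - t i)\<^sup>2) * K\<^sup>2"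
        using Suc by blast
      have "\<exists>c'\<in>C. (norm (S (Suc j) - t (Suc j) *\<^sub>R c'))\<^sup>2 \<le>
          (\<Sum>i<j. (t (Suc i) - t i)\<^sup>2) * K\<^sup>2 + h\<^sup>2 * K\<^sup>2"
        unfolding q h(2) using Suc h(1) c by (intro step[of "t j" h "S j" c]) auto
      moreover have "(\<Sum>i<Suc j. (t (Suc i) - t i)\<^sup>2) * K\<^sup>2 = (\<Sum>i<j. (t (Suc i) - t i)\<^sup>2) * K\<^sup>2 + h\<^sup>2 * K\<^sup>2"
        by (simp add: h_def algebra_simps)
      moreover have "norm (S (Suc j)) \<le> M * t (Suc j)"
      proof -
        have "norm (h *\<^sub>R mixed_payoff u (\<xi> (S j /\<^sub>R t j)) q) \<le> h * M"
          using h(1) norm_mixed_payoff_le[of u _ q] by (simp add: M_def mult_left_mono)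
        moreover have "norm (S (Suc j)) \<le> norm (S j) + norm (h *\<^sub>R mixed_payoff u (\<xi> (S j /\<^sub>R t j)) q)"
          unfolding q by (rule norm_triangle_ineq)
        moreover have "norm (S j) \<le> M * t j" using Suc by blast
        ultimately show ?thesis unfolding h(2) by (simp add: algebra_simps)
      qed
      ultimately show ?case using Suc h by simp
    qed
    then show "\<exists>c\<in>C. (norm (S j - t j *\<^sub>R c))\<^sup>2 \<le> (\<Sum>i<j. (t (Suc i) - t i)\<^sup>2) * K\<^sup>2" by blast
  qed
  then show ?thesis by blast
qed


section \<open>Tracking in continuous time\<close>

text \<open>
  From block \<open>N\<close> on, the strategy plays \<open>\<xi>\<close> of the average payoff since time \<open>\<tau> N\<close>. Actions
  are constant on blocks, so each block is one step of the discrete estimate; the end time \<open>t\<close> need not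
  be on the grid, and the bound is uniform in \<open>t\<close>.
\<close>

lemma block_strategy_tracks:
  fixes u :: "'a::finite \<Rightarrow> 'b::finite \<Rightarrow> real ^ 'm"
  assumes tracks: "tracks u C \<xi> K" and grid: "time_grid \<tau>" and b: "b \<in> controls" and Nt: "\<tau> N \<le> t"
    and sel: "\<And>h. N \<le> length h \<Longrightarrow> \<tau> (length h) < t \<Longrightarrow>
      sel h = \<xi> (sum_list (drop N h) /\<^sub>R (\<tau> (length h) - \<tau> N))"
    and \<delta>: "\<And>n. (\<Sum>i<n. (\<tau> (Suc i) - \<tau> i)\<^sup>2) \<le> \<delta>"
  shows "\<exists>c\<in>C. (norm (integral {\<tau> N..t} (\<lambda>r. mixed_payoff u (block_strategy u \<tau> sel b r) (b r))
      - (t - \<tau> N) *\<^sub>R c))\<^sup>2 \<le> \<delta> * K\<^sup>2"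
proof -
  let ?a = "block_strategy u \<tau> sel b"
  let ?f = "\<lambda>r. mixed_payoff u (?a r) (b r)"
  have mono: "\<tau> i \<le> \<tau> j" if "i \<le> j" for i j
    using grid that by (simp add: time_grid_def strict_mono_less_eq)
  \<comment> \<open>Times beyond t are cut off: the corresponding steps have length zero.\<close>
  define s where "s j = min (\<tau> (N + j)) t" for j
  define S where "S j = integral {\<tau> N..s j} ?f" for j
  have s_mono: "s j \<le> s (Suc j)" for j
    using mono[of "N + j" "N + Suc j"] by (simp add: s_def)
  have step: "\<exists>q. S (Suc j) = S j + ((s (Suc j) - \<tau> N) - (s j - \<tau> N)) *\<^sub>R
      mixed_payoff u (\<xi> (S j /\<^sub>R (s j - \<tau> N))) q" for j
  proof (cases "\<tau> (N + j) < t")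
    case True
    let ?k = "N + j" and ?p = "\<xi> (S j /\<^sub>R (s j - \<tau> N))"
    have sj: "s j = \<tau> ?k" using True by (simp add: s_def)
    have "sel (block_payoffs u \<tau> sel b ?k) = ?p"
      using sel[of "block_payoffs u \<tau> sel b ?k"] sum_list_drop_block_payoffs[OF grid b, of N ?k u sel] True
      by (simp add: S_def sj)
    then have "?a r = ?p" if "r \<in> {s j..<s (Suc j)}" for r
      using block_strategy_on_block[OF grid, of ?k r u sel b] that by (simp add: sj) (simp add: s_def)
    then obtain q where "integral {s j..s (Suc j)} ?f = (s (Suc j) - s j) *\<^sub>R mixed_payoff u ?p q"
      using payoff_against_constant_left[OF b _ s_mono, of j ?a ?p u] time_grid_nonneg[OF grid, of ?k]
      by (auto simp: sj)
    moreover have "integral {\<tau> N..s j} ?f + integral {s j..s (Suc j)} ?f = integral {\<tau> N..s (Suc j)} ?f"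
      using s_mono[of j] mono[of N ?k]
      by (intro Henstock_Kurzweil_Integration.integral_combine integrable_on_payoff
          block_strategy_in_controls b time_grid_nonneg[OF grid]) (simp_all add: sj)
    ultimately show ?thesis by (intro exI[of _ q]) (simp add: S_def)
  next
    case False
    then have "s (Suc j) = s j" using mono[of "N + j" "N + Suc j"] by (simp add: s_def)
    then show ?thesis by (simp add: S_def)
  qed
  have "\<exists>j. t \<le> \<tau> j"
    using grid by (auto simp: time_grid_def filterlim_at_top eventually_sequentially)
  then obtain j where "t \<le> \<tau> j" by blast
  then have sj: "s j = t" using mono[of j "N + j"] by (simp add: s_def)
  have "\<exists>c\<in>C. (norm (S j - (s j - \<tau> N) *\<^sub>R c))\<^sup>2 \<le>
      (\<Sum>i<j. ((s (Suc i) - \<tau> N) - (s i - \<tau> N))\<^sup>2) * K\<^sup>2"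
    using tracks step s_mono Nt unfolding tracks_def
    by (elim conjE allE[of _ S] allE[of _ "\<lambda>j. s j - \<tau> N"]) (simp add: S_def s_def)
  moreover have "(\<Sum>i<j. ((s (Suc i) - \<tau> N) - (s i - \<tau> N))\<^sup>2) \<le> \<delta>"
  proof -
    have "(\<Sum>i<j. ((s (Suc i) - \<tau> N) - (s i - \<tau> N))\<^sup>2) \<le> (\<Sum>i<j. (\<tau> (Suc (N + i)) - \<tau> (N + i))\<^sup>2)"
    proof (intro sum_mono power_mono)
      fix i
      show "(s (Suc i) - \<tau> N) - (s i - \<tau> N) \<le> \<tau> (Suc (N + i)) - \<tau> (N + i)"
        using mono[of "N + i" "Suc (N + i)"] by (simp add: s_def min_def)
    qed (use s_mono in simp)
    also have "\<dots> = (\<Sum>i\<in>(+) N ` {..<j}. (\<tau> (Suc i) - \<tau> i)\<^sup>2)"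
      by (simp add: sum.reindex)
    also have "\<dots> \<le> (\<Sum>i<N + j. (\<tau> (Suc i) - \<tau> i)\<^sup>2)"
      by (intro sum_mono2) auto
    also have "\<dots> \<le> \<delta>" by (rule \<delta>)
    finally show ?thesis .
  qed
  then have "(\<Sum>i<j. ((s (Suc i) - \<tau> N) - (s i - \<tau> N))\<^sup>2) * K\<^sup>2 \<le> \<delta> * K\<^sup>2"
    by (rule mult_right_mono) simp
  ultimately show ?thesis
    unfolding sj S_def using order_trans by blast
qed

text \<open>
  Harmonic step lengths have a divergent sum, so they fill the whole time axis, but summable squares,
  so the error stays bounded for all times; scaling them by \<open>c\<close> makes the error as small as desired.
\<close>

lemma time_grid_harm:
  assumes "c > 0"
  shows "time_grid (\<lambda>k. c * harm k)"
  unfolding time_grid_def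
proof (intro conjI)
  show "strict_mono (\<lambda>k. c * harm k)"
    using assms by (auto simp: strict_mono_Suc_iff harm_Suc)
  show "filterlim (\<lambda>k. c * harm k) at_top sequentially"
    by (rule filterlim_tendsto_pos_mult_at_top[OF tendsto_const assms harm_at_top])
qed (simp add: harm_def)

lemma sum_squared_harm_steps_le:
  "(\<Sum>i<n. (c * harm (Suc i) - c * harm i)\<^sup>2) \<le> 2 * c\<^sup>2" for c :: real
proof -
  have "(\<Sum>i<n. (inverse (real (Suc i)))\<^sup>2) \<le> 2 - inverse (real n)"
  proof (induction n)
    case (Suc n)
    have "(inverse (real (Suc n)))\<^sup>2 \<le> inverse (real n) - inverse (real (Suc n))" if "n > 0"
    proof -
      have "inverse (real (Suc n)) * inverse (real (Suc n)) \<le> inverse (real n) * inverse (real (Suc n))"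
        using that by (intro mult_right_mono) (simp_all add: le_imp_inverse_le)
      also have "\<dots> = inverse (real n) - inverse (real (Suc n))"
        using that by (simp add: field_simps)
      finally show ?thesis by (simp only: power2_eq_square)
    qed
    then show ?case using Suc by (cases "n = 0") auto
  qed simp
  also have "\<dots> \<le> 2" by simp
  finally have "c\<^sup>2 * (\<Sum>i<n. (inverse (real (Suc i)))\<^sup>2) \<le> c\<^sup>2 * 2"
    by (intro mult_left_mono) auto
  moreover have "(c * harm (Suc i) - c * harm i)\<^sup>2 = c\<^sup>2 * (inverse (real (Suc i)))\<^sup>2" for i
    by (simp add: harm_Suc power_mult_distrib[symmetric] distrib_left)
  ultimately show ?thesis by (simp add: sum_distrib_left[symmetric] mult.commute)
qed

section \<open>Sufficiency\<close>

text \<open>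
  Until time \<open>\<alpha>\<close> Player 1 tracks \<open>t C\<close>, and from then on tracks \<open>(t - \<alpha>) C'\<close> with the payoff collected
  after \<open>\<alpha>\<close>. The sum of the two tracked points is a point of \<open>\<alpha> C + Cone C'\<close>.
\<close>

lemma attainable_if_B_sets:
  fixes u :: "'a::finite \<Rightarrow> 'b::finite \<Rightarrow> real ^ 'm"
  assumes "\<alpha> > 0" and C: "B_set u C" and C': "B_set u C'" and "closed Y"
    and sub: "{\<alpha> *\<^sub>R c + w | c w. c \<in> C \<and> w \<in> Cone C'} \<subseteq> Y"
  shows "attainable u Y"
proof -
  have inY: "\<alpha> *\<^sub>R c + \<beta> *\<^sub>R c' \<in> Y" if "c \<in> C" "c' \<in> C'" "0 \<le> \<beta>" for c c' \<beta>
    using sub that unfolding Cone_def by blast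
  obtain c c' where "c \<in> C" "c' \<in> C'" using C C' unfolding B_set_def by blast
  then have "Y \<noteq> {}" using inY[of c c' 0] by auto
  obtain \<xi>1 K1 \<xi>2 K2 where tracks1: "tracks u C \<xi>1 K1" and tracks2: "tracks u C' \<xi>2 K2"
    using B_set_tracking[OF C] B_set_tracking[OF C'] by blast
  then have K1: "K1 \<ge> 0" and K2: "K2 \<ge> 0" by (simp_all add: tracks_def)
  have "\<exists>\<sigma>1\<in>strategies. \<forall>t\<ge>\<alpha>. \<forall>\<sigma>2\<in>strategies. infdist (cumulative_payoff u \<sigma>1 \<sigma>2 t) Y \<le> \<epsilon>"
    if \<epsilon>: "\<epsilon> > 0" for \<epsilon>
  proof -
    define L where "L = 1 + K1 + K2"
    have L: "L > 0" "K1 \<le> L" "K2 \<le> L" using K1 K2 by (auto simp: L_def)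
    have "\<forall>\<^sub>F n in sequentially. harm n \<ge> 4 * \<alpha> * L / \<epsilon>"
      using harm_at_top unfolding filterlim_at_top by blast
    then obtain N where N: "harm N \<ge> 4 * \<alpha> * L / \<epsilon>" unfolding eventually_sequentially by blast
    moreover have "4 * \<alpha> * L / \<epsilon> > 0" using L(1) \<epsilon> \<open>\<alpha> > 0\<close> by simp
    ultimately have hN: "harm N > (0::real)" by linarith
    \<comment> \<open>The scale of the grid makes \<open>\<alpha>\<close> its N-th point and, N being large, is small compared with \<open>\<epsilon>\<close>.\<close>
    define c where "c = \<alpha> / harm N"
    have "c > 0" using hN \<open>\<alpha> > 0\<close> by (simp add: c_def)
    have "c * L \<le> \<epsilon> / 4" using N hN \<epsilon> by (simp add: c_def field_simps)
    \<comment> \<open>On this grid the bound for the squared tracking error is \<open>2 c\<^sup>2 K\<^sup>2\<close>.\<close>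
    have small: "x \<le> \<epsilon> / 2" if "x\<^sup>2 \<le> 2 * c\<^sup>2 * K\<^sup>2" "0 \<le> K" "K \<le> L" for x K :: real
    proof (rule power2_le_imp_le)
      have "c * K \<le> \<epsilon> / 4"
        using \<open>c * L \<le> \<epsilon> / 4\<close> that(3) \<open>c > 0\<close> mult_left_mono[of K L c] by linarith
      then have "(c * K)\<^sup>2 \<le> (\<epsilon> / 4)\<^sup>2" using \<open>c > 0\<close> that(2) by (intro power_mono) auto
      moreover have "x\<^sup>2 \<le> 2 * (c * K)\<^sup>2"
        using that(1) by (simp add: power_mult_distrib mult.assoc)
      moreover have "(\<epsilon> / 2)\<^sup>2 = 4 * (\<epsilon> / 4)\<^sup>2" by (simp add: power_divide)
      ultimately show "x\<^sup>2 \<le> (\<epsilon> / 2)\<^sup>2" using zero_le_power2[of "c * K"] by linarith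
    qed (use \<epsilon> in simp)
    define \<tau> where "\<tau> k = c * harm k" for k
    have grid: "time_grid \<tau>" unfolding \<tau>_def by (rule time_grid_harm[OF \<open>c > 0\<close>])
    have sq: "(\<Sum>i<n. (\<tau> (Suc i) - \<tau> i)\<^sup>2) \<le> 2 * c\<^sup>2" for n
      unfolding \<tau>_def by (rule sum_squared_harm_steps_le)
    have \<tau>N: "\<tau> N = \<alpha>" and \<tau>0: "\<tau> 0 = 0" using hN by (simp_all add: \<tau>_def c_def harm_expand(1) del: harm_pos_iff)
    have before: "k < N \<longleftrightarrow> \<tau> k < \<alpha>" for k
      using grid \<tau>N by (metis strict_mono_less time_grid_def)
    define sel where "sel h = (if length h < N then \<xi>1 (sum_list h /\<^sub>R \<tau> (length h))
      else \<xi>2 (sum_list (drop N h) /\<^sub>R (\<tau> (length h) - \<alpha>)))" for h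
    let ?\<sigma>1 = "block_strategy u \<tau> sel"
    have strat: "?\<sigma>1 \<in> strategies" by (rule block_strategy_in_strategies[OF grid])
    have "infdist (cumulative_payoff u ?\<sigma>1 \<sigma>2 t) Y \<le> \<epsilon>" if t: "t \<ge> \<alpha>" and \<sigma>2: "\<sigma>2 \<in> strategies" for t \<sigma>2
    proof -
      obtain a b where ab: "a \<in> controls" "b \<in> controls" "?\<sigma>1 b = a" "\<sigma>2 a = b"
        and pay: "\<And>t. cumulative_payoff u ?\<sigma>1 \<sigma>2 t = integral {0..t} (\<lambda>r. mixed_payoff u (a r) (b r))"
        by (rule cumulative_payoff_along_play_path[OF strat \<sigma>2, of u]) (rule that)
      define f where "f = (\<lambda>r. mixed_payoff u (a r) (b r))"
      have "\<exists>c1\<in>C. (norm (integral {\<tau> 0..\<alpha>} f - (\<alpha> - \<tau> 0) *\<^sub>R c1))\<^sup>2 \<le> 2 * c\<^sup>2 * K1\<^sup>2"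
        unfolding f_def ab(3)[symmetric]
        by (rule block_strategy_tracks[OF tracks1 grid ab(2) _ _ sq]) (use before \<open>\<alpha> > 0\<close> in \<open>auto simp: \<tau>0 sel_def\<close>)
      then obtain c1 where c1: "c1 \<in> C" "norm (integral {0..\<alpha>} f - \<alpha> *\<^sub>R c1) \<le> \<epsilon> / 2"
        using small K1 L(2) by (auto simp: \<tau>0)
      have "\<exists>c2\<in>C'. (norm (integral {\<tau> N..t} f - (t - \<tau> N) *\<^sub>R c2))\<^sup>2 \<le> 2 * c\<^sup>2 * K2\<^sup>2"
        unfolding f_def ab(3)[symmetric]
        by (rule block_strategy_tracks[OF tracks2 grid ab(2) _ _ sq]) (use t in \<open>auto simp: \<tau>N sel_def\<close>)
      then obtain c2 where c2: "c2 \<in> C'" "norm (integral {\<alpha>..t} f - (t - \<alpha>) *\<^sub>R c2) \<le> \<epsilon> / 2"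
        using small K2 L(3) by (auto simp: \<tau>N)
      have "integral {0..\<alpha>} f + integral {\<alpha>..t} f = integral {0..t} f"
        using t \<open>\<alpha> > 0\<close> unfolding f_def
        by (intro Henstock_Kurzweil_Integration.integral_combine integrable_on_payoff ab) auto
      then have split: "cumulative_payoff u ?\<sigma>1 \<sigma>2 t - (\<alpha> *\<^sub>R c1 + (t - \<alpha>) *\<^sub>R c2) =
          (integral {0..\<alpha>} f - \<alpha> *\<^sub>R c1) + (integral {\<alpha>..t} f - (t - \<alpha>) *\<^sub>R c2)"
        by (simp add: pay f_def)
      have "dist (cumulative_payoff u ?\<sigma>1 \<sigma>2 t) (\<alpha> *\<^sub>R c1 + (t - \<alpha>) *\<^sub>R c2) \<le> \<epsilon>"
        unfolding dist_norm split by (rule norm_triangle_le) (use c1(2) c2(2) in linarith)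
      then show ?thesis
        using inY[OF c1(1) c2(1), of "t - \<alpha>"] t by (intro infdist_le2) auto
    qed
    then show ?thesis using strat by blast
  qed
  then show ?thesis
    unfolding attainable_def using \<open>Y \<noteq> {}\<close> \<open>closed Y\<close> \<open>\<alpha> > 0\<close> by blast
qed

theorem theorem1:
  fixes u :: "'a::finite \<Rightarrow> 'b::finite \<Rightarrow> real ^ 'm"
    and Y :: "(real ^ 'm) set"
  assumes "\<forall>x y i. u x y $ i \<in> {-1..1}"
    and "closed Y" and "convex Y"
  shows "attainable u Y \<longleftrightarrow>
    (\<exists>\<alpha>>0. \<exists>C C'. B_set u C \<and> B_set u C' \<and>
       {\<alpha> *\<^sub>R c + w | c w. c \<in> C \<and> w \<in> Cone C'} \<subseteq> Y)"
proof
  assume "attainable u Y"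
  then obtain T where T: "T > 0" "B_set u ((\<lambda>y. y /\<^sub>R T) ` Y)" "B_set u (recession_cone Y)"
    using B_sets_if_attainable assms(2,3) by blast
  have "{T *\<^sub>R c + w | c w. c \<in> (\<lambda>y. y /\<^sub>R T) ` Y \<and> w \<in> Cone (recession_cone Y)} \<subseteq> Y"
    using T(1) by (auto simp: Cone_def recession_cone_def)
  then show "\<exists>\<alpha>>0. \<exists>C C'. B_set u C \<and> B_set u C' \<and>
       {\<alpha> *\<^sub>R c + w | c w. c \<in> C \<and> w \<in> Cone C'} \<subseteq> Y"
    using T by blast
next
  assume "\<exists>\<alpha>>0. \<exists>C C'. B_set u C \<and> B_set u C' \<and>
       {\<alpha> *\<^sub>R c + w | c w. c \<in> C \<and> w \<in> Cone C'} \<subseteq> Y"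
  then show "attainable u Y"
    using attainable_if_B_sets assms(2) by blast
qed

end
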